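(* Let $q=2^n$ with $n\ge 3$, let $h$ be a positive integer with $\gcd(n,h)=1$, and let $\mathcal A\subset \mathrm{PG}(3,q)$ and $G_h$ be the $(q+1)$-arc and its group as defined in the context. Then $G_h$ has exactly five orbits on the points of $\mathrm{PG}(3,q)$: (1) $\mathcal A$, of size $q+1$; (2) $\mathcal O_0$, of size $(q^3-q)/3$, consisting of the points not contained in any osculating plane; (3) $\mathcal O_1$, of size $(q^3-q)/2$, consisting of the points of $\mathrm{PG}(3,q)\setminus\mathcal A$ lying on exactly one osculating plane; (4) $\mathcal O_2=\mathcal Q^+(3,q)\setminus\mathcal A$, of size $q^2+q$, consisting of the points lying on exactly two osculating planes; (5) $\mathcal O_3$, of size $(q^3-q)/6$, consisting of the points lying on exactly three osculating planes.
   Context: Points of $\mathrm{PG}(3,q)$ have homogeneous coordinates $(X_1,X_2,X_3,X_4)$, written as column vectors when acted on by matrices; $U_i$ is the point with $1$ in position $i$ and $0$ elsewhere. $\mathcal A=\{P_t=(1,t,t^{2^h},t^{2^h+1})\mid t\in\mathbb F_q\}\cup\{U_4\}$. $G_h\simeq \mathrm{PGL}(2,q)$ is the group of projectivities of $\mathrm{PG}(3,q)$ stabilizing $\mathcal A$; its elements are represented by the matrices $$M_{a,b,c,d}=\begin{pmatrix} a^{2^h+1}&a^{2^h}b&ab^{2^h}&b^{2^h+1}\\ a^{2^h}c&a^{2^h}d&b^{2^h}c&b^{2^h}d\\ ac^{2^h}&bc^{2^h}&ad^{2^h}&bd^{2^h}\\ c^{2^h+1}&c^{2^h}d&cd^{2^h}&d^{2^h+1}\end{pmatrix},\quad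 a,b,c,d\in\mathbb F_q,\ ad+bc=1.$$ $\mathfrak s$ is the symplectic polarity of $\mathrm{PG}(3,q)$ defined by the alternating form $x_1y_4+x_2y_3+x_3y_2+x_4y_1$. The osculating planes are the $q+1$ planes $P^{\mathfrak s}$, $P\in\mathcal A$: $P_t^{\mathfrak s}: t^{2^h+1}X_1+t^{2^h}X_2+tX_3+X_4=0$ and $U_4^{\mathfrak s}:X_1=0$. $\mathcal Q^+(3,q)$ is the hyperbolic quadric $X_1X_4+X_2X_3=0$. *)

theory Defs
  imports "HOL-Analysis.Analysis" "HOL-Algebra.Group_Action"
begin

text \<open>
  The finite field is a type \<^typ>\<open>'a\<close> of class \<^class>\<open>field\<close> and \<^class>\<open>finite\<close>; the homogeneous
  coordinates \<open>X\<^sub>1, \<dots>, X\<^sub>4\<close> of a vector \<open>v\<close> are \<open>v $ 1, \<dots>, v $ 4\<close>.  Points and planes of the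
  projective space are linear subspaces of \<open>'a ^ 4\<close>, and incidence is inclusion.
\<close>

definition pt :: "'a::field ^ 4 \<Rightarrow> ('a ^ 4) set" where
  "pt v = vec.span {v}"

definition PG3 :: "('a::field ^ 4) set set" where
  "PG3 = {pt v | v. v \<noteq> 0}"

text \<open>
  A projectivity is restricted to the point set, so that matrices differing by a nonzero scalar give
  the same projectivity.
\<close>

definition projectivity :: "'a::field ^ 4 ^ 4 \<Rightarrow> ('a ^ 4) set \<Rightarrow> ('a ^ 4) set" where
  "projectivity M = (\<lambda>P \<in> PG3. (\<lambda>v. M *v v) ` P)"

definition PGL4 :: "(('a::field ^ 4) set \<Rightarrow> ('a ^ 4) set) monoid" where
  "PGL4 = BijGroup PG3 \<lparr>carrier := {projectivity M | M. invertible M}\<rparr>"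

definition qarc :: "nat \<Rightarrow> ('a::field ^ 4) set set" where
  "qarc h = {pt (vector [1, t, t ^ (2 ^ h), t ^ (2 ^ h + 1)]) | t. True} \<union> {pt (axis 4 1)}"

definition arc_group :: "nat \<Rightarrow> (('a::field ^ 4) set \<Rightarrow> ('a ^ 4) set) monoid" where
  "arc_group h = PGL4 \<lparr>carrier := {g \<in> carrier PGL4. g ` qarc h = qarc h}\<rparr>"

text \<open>The form is alternating in characteristic 2, the only case in which it is used.\<close>

definition sympl_form :: "'a::field ^ 4 \<Rightarrow> 'a ^ 4 \<Rightarrow> 'a" where
  "sympl_form x y = x $ 1 * y $ 4 + x $ 2 * y $ 3 + x $ 3 * y $ 2 + x $ 4 * y $ 1"

definition polarity :: "('a::field ^ 4) set \<Rightarrow> ('a ^ 4) set" where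
  "polarity S = {y. \<forall>x \<in> S. sympl_form x y = 0}"

definition osculating_planes :: "nat \<Rightarrow> ('a::field ^ 4) set set" where
  "osculating_planes h = polarity ` qarc h"

definition num_osculating :: "nat \<Rightarrow> ('a::field ^ 4) set \<Rightarrow> nat" where
  "num_osculating h P = card {\<pi> \<in> osculating_planes h. P \<subseteq> \<pi>}"

definition hyperbolic_quadric :: "('a::field ^ 4) set set" where
  "hyperbolic_quadric = {P \<in> PG3. \<forall>x \<in> P. x $ 1 * x $ 4 + x $ 2 * x $ 3 = 0}"

lemma vector_4:
  fixes x y z w :: "'a::zero"
  shows "(vector [x, y, z, w] :: 'a ^ 4) $ 1 = x" "(vector [x, y, z, w] :: 'a ^ 4) $ 2 = y"
    "(vector [x, y, z, w] :: 'a ^ 4) $ 3 = z" "(vector [x, y, z, w] :: 'a ^ 4) $ 4 = w"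
  by (simp_all add: vector_def)

lemma image_pt: "(\<lambda>v. M *v v) ` pt v = pt (M *v v)"
  by (auto simp: pt_def vec.span_singleton image_iff vec.scale)

lemma invertible_mult_nonzero:
  fixes M :: "'a::field ^ 4 ^ 4"
  assumes "invertible M" and "v \<noteq> 0"
  shows "M *v v \<noteq> 0"
proof -
  obtain N where "N ** M = mat 1" using assms(1) by (auto simp: invertible_def)
  then have "N *v (M *v v) = v" by (simp add: matrix_vector_mul_assoc)
  then show ?thesis using assms(2) by auto
qed

lemma projectivity_in_PG3:
  "invertible M \<Longrightarrow> P \<in> PG3 \<Longrightarrow> projectivity M P \<in> PG3"
  using invertible_mult_nonzero by (fastforce simp: projectivity_def PG3_def image_pt)

lemma projectivity_mult:
  assumes "invertible N"
  shows "compose PG3 (projectivity M) (projectivity N) = projectivity (M ** N)"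
proof
  fix P
  show "compose PG3 (projectivity M) (projectivity N) P = projectivity (M ** N) P"
    using projectivity_in_PG3[OF assms, of P]
    by (auto simp: compose_def projectivity_def image_image matrix_vector_mul_assoc)
qed

lemma projectivity_one: "projectivity (mat 1) = (\<lambda>P \<in> PG3. P)"
  by (auto simp: projectivity_def)

lemma invertible_inverse:
  fixes M :: "'a::field ^ 4 ^ 4"
  assumes "invertible M"
  obtains N where "invertible N" "M ** N = mat 1" "N ** M = mat 1"
  using assms by (auto simp: invertible_def)

lemma projectivity_Bij:
  assumes "invertible M"
  shows "projectivity M \<in> Bij PG3"
proof -
  obtain N where N: "invertible N" "M ** N = mat 1" "N ** M = mat 1"
    using invertible_inverse[OF assms] .
  have "projectivity N (projectivity M P) = P" "projectivity M (projectivity N P) = P"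
    if "P \<in> PG3" for P
    using projectivity_mult[OF assms, of N] projectivity_mult[OF N(1), of M] that N(2,3)
    by (metis compose_eq projectivity_one restrict_apply')+
  then have "bij_betw (projectivity M) PG3 PG3"
    by (intro bij_betwI[where g = "projectivity N"])
       (auto intro: projectivity_in_PG3 assms N(1))
  then show ?thesis by (auto simp: Bij_def projectivity_def)
qed

lemma qarc_subset: "qarc h \<subseteq> PG3"
proof -
  have "vector [1, t, t ^ (2 ^ h), t ^ (2 ^ h + 1)] \<noteq> (0 :: 'a ^ 4)" for t :: 'a
    by (metis vector_4(1) zero_index zero_neq_one)
  moreover have "axis 4 1 \<noteq> (0 :: 'a ^ 4)" by (simp add: axis_eq_0_iff)
  ultimately show ?thesis unfolding qarc_def PG3_def by blast
qed

text \<open>The stabilizer of the arc acts on the points, so its orbits partition them.\<close>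

lemma group_action_arc_group:
  "group_action (arc_group h) (PG3 :: ('a::field ^ 4) set set) (\<lambda>g. g)"
proof -
  let ?B = "BijGroup (PG3 :: ('a ^ 4) set set)"
  let ?G = "carrier (arc_group h :: (('a ^ 4) set \<Rightarrow> ('a ^ 4) set) monoid)"
  have G: "?G = {projectivity M | M. invertible M \<and> projectivity M ` qarc h = qarc h}"
    by (auto simp: arc_group_def PGL4_def)
  have sub: "?G \<subseteq> Bij PG3" unfolding G using projectivity_Bij by blast
  have one: "\<one>\<^bsub>?B\<^esub> \<in> ?G"
  proof -
    have "projectivity (mat 1) ` qarc h = (qarc h :: ('a ^ 4) set set)"
      using qarc_subset[of h] by (force simp: projectivity_one)
    moreover have "invertible (mat 1 :: 'a ^ 4 ^ 4)"
      unfolding invertible_def by (metis matrix_mul_lid)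
    ultimately show ?thesis
      unfolding G BijGroup_def monoid.simps projectivity_one[symmetric] by blast
  qed
  have mult: "f \<otimes>\<^bsub>?B\<^esub> g \<in> ?G" if fg: "f \<in> ?G" "g \<in> ?G" for f g
  proof -
    obtain M N where M: "f = projectivity M" "invertible M" "f ` qarc h = qarc h"
      and N: "g = projectivity N" "invertible N" "g ` qarc h = qarc h"
      using fg unfolding G by auto
    have eq: "f \<otimes>\<^bsub>?B\<^esub> g = projectivity (M ** N)"
      using sub fg M N by (auto simp: BijGroup_def projectivity_mult)
    have "compose PG3 f g ` qarc h = f ` g ` qarc h"
      using qarc_subset[of h] by (force simp: compose_def)
    then have "projectivity (M ** N) ` qarc h = qarc h"
      using M N by (simp add: projectivity_mult)
    moreover have "invertible (M ** N)" using M(2) N(2) by (rule invertible_mult)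
    ultimately show ?thesis unfolding eq G by blast
  qed
  have inv: "inv\<^bsub>?B\<^esub> f \<in> ?G" if f: "f \<in> ?G" for f
  proof -
    obtain M where M: "f = projectivity M" "invertible M" "f ` qarc h = qarc h"
      using f unfolding G by auto
    obtain N where N: "invertible N" "M ** N = mat 1" "N ** M = mat 1"
      using invertible_inverse[OF M(2)] .
    have c: "compose PG3 (projectivity N) f = (\<lambda>P \<in> PG3. P)"
      using projectivity_mult[OF M(2), of N] N M by (simp add: projectivity_one)
    then have "projectivity N \<otimes>\<^bsub>?B\<^esub> f = \<one>\<^bsub>?B\<^esub>"
      using projectivity_Bij[OF N(1)] f sub by (auto simp: BijGroup_def)
    then have eq: "inv\<^bsub>?B\<^esub> f = projectivity N"
      using projectivity_Bij[OF N(1)] f sub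
      by (intro group.inv_equality[OF group_BijGroup]) (auto simp: BijGroup_def)
    have "projectivity N ` qarc h = projectivity N ` f ` qarc h" using M by simp
    also have "\<dots> = compose PG3 (projectivity N) f ` qarc h"
      using qarc_subset[of h] by (force simp: compose_def)
    also have "\<dots> = qarc h" unfolding c using qarc_subset[of h] by force
    finally show ?thesis unfolding eq G using N by blast
  qed
  have "subgroup ?G ?B"
    using sub one mult inv by (intro subgroup.intro) (auto simp: BijGroup_def)
  moreover have "arc_group h = ?B \<lparr>carrier := ?G\<rparr>" by (simp add: arc_group_def PGL4_def)
  ultimately have "group (arc_group h :: (('a ^ 4) set \<Rightarrow> ('a ^ 4) set) monoid)"
    and "(\<lambda>g. g) \<in> hom (arc_group h) ?B"
    using group.subgroup_imp_group[OF group_BijGroup, of ?G PG3] sub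
    by (simp_all add: hom_def arc_group_def PGL4_def BijGroup_def subset_iff)
  then show ?thesis
    by (auto intro!: group_action.intro group_hom.intro group_hom_axioms.intro group_BijGroup)
qed

end

theory Submission
  imports Defs "HOL-Number_Theory.Residues"
begin

text \<open>
  Write \<open>\<sigma>\<close> for the automorphism \<open>x \<mapsto> x ^ 2 ^ h\<close>, whose fixed field is the prime field. Arranging the coordinates
  of a point in a 2 by 2 matrix \<open>V\<close>, the matrix \<open>M\<^bsub>a,b,c,d\<^esub>\<close> acts by \<open>V \<mapsto> \<sigma>(g) V g\<^sup>T\<close>, and the osculating
  planes through the point correspond to the zeros on the projective line of a form attached to \<open>V\<close>.
  Moving zeros to infinity, 0 and 1 brings every point that lies on an osculating plane to one of
  four normal forms, and the orbit-stabilizer theorem for \<open>SL(2,q)\<close> yields their orbit sizes. A point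
  that lies on no osculating plane has a stabilizer of order at most 3, because the stabilizer
  consists of nonzero elements of a division algebra of order at most 4 over the prime field; since
  exactly \<open>(q\<^sup>3 - q)/3\<close> such points remain, they form one orbit. The full stabilizer of the arc does
  not merge these orbits: it permutes the osculating planes, since the tangent lines spanning them
  are determined by the secants of the arc.
\<close>

section \<open>Powers of the Frobenius map and the twisted tensor matrices\<close>

definition frob :: "nat \<Rightarrow> 'a::field \<Rightarrow> 'a" where
  "frob h x = x ^ (2 ^ h)"

lemma frob_mult: "frob h (x * y) = frob h x * frob h y"
  by (simp add: frob_def power_mult_distrib)

lemma frob_0 [simp]: "frob h 0 = 0"
  and frob_1 [simp]: "frob h 1 = 1"
  by (simp_all add: frob_def)

lemma frob_eq_0_iff [simp]: "frob h x = 0 \<longleftrightarrow> x = 0"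
  by (simp add: frob_def)

lemma frob_divide: "frob h (x / y) = frob h x / frob h y"
  by (simp add: frob_def power_divide)

text \<open>Multiplication by a nonzero x permutes the nonzero elements, so it leaves their product
  unchanged while multiplying it by x^(q-1).\<close>

lemma power_CARD:
  fixes x :: "'a::{field,finite}"
  shows "x ^ CARD('a) = x"
proof (cases "x = 0")
  case False
  have "bij_betw ((*) x) (UNIV - {0}) (UNIV - {0})"
    using False by (intro bij_betwI[where g = "\<lambda>y. y / x"]) auto
  then have "(\<Prod>y\<in>UNIV - {0}. x * y) = (\<Prod>y\<in>UNIV - {0}. y)"
    by (rule prod.reindex_bij_betw)
  then have "x ^ card (UNIV - {0::'a}) = 1"
    by (simp add: prod.distrib)
  moreover have "CARD('a) = Suc (card (UNIV - {0::'a}))"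
    by (rule card.remove) auto
  ultimately show ?thesis by (simp only: power_Suc mult_1_right)
qed (simp add: zero_less_card_finite)

text \<open>The Kronecker product of \<open>\<sigma>(g)\<close> and \<open>g\<close>.\<close>

definition twmat :: "nat \<Rightarrow> 'a::field \<times> 'a \<times> 'a \<times> 'a \<Rightarrow> 'a ^ 4 ^ 4" where
  "twmat h = (\<lambda>(a, b, c, d). vector [
     vector [frob h a * a, frob h a * b, frob h b * a, frob h b * b],
     vector [frob h a * c, frob h a * d, frob h b * c, frob h b * d],
     vector [frob h c * a, frob h c * b, frob h d * a, frob h d * b],
     vector [frob h c * c, frob h c * d, frob h d * c, frob h d * d]])"

text \<open>The pure tensor of (\<sigma>(x), \<sigma>(y)) and (x, y): a homogeneous parametrization
  of the arc that treats U_4 like the other points.\<close>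

definition twvec :: "nat \<Rightarrow> 'a::field \<Rightarrow> 'a \<Rightarrow> 'a ^ 4" where
  "twvec h x y = vector [frob h x * x, frob h x * y, frob h y * x, frob h y * y]"

lemma vec4_eq_iff: "v = w \<longleftrightarrow> v $ 1 = w $ 1 \<and> v $ 2 = w $ 2 \<and> v $ 3 = w $ 3 \<and> v $ 4 = w $ 4"
  for v w :: "'b ^ 4"
  by (simp add: vec_eq_iff forall_4)

lemma twmat_mult_vec:
  fixes v :: "'a::field ^ 4"
  shows "twmat h (a, b, c, d) *v v = vector
    [frob h a * (a * v $ 1 + b * v $ 2) + frob h b * (a * v $ 3 + b * v $ 4),
     frob h a * (c * v $ 1 + d * v $ 2) + frob h b * (c * v $ 3 + d * v $ 4),
     frob h c * (a * v $ 1 + b * v $ 2) + frob h d * (a * v $ 3 + b * v $ 4),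
     frob h c * (c * v $ 1 + d * v $ 2) + frob h d * (c * v $ 3 + d * v $ 4)]"
  by (simp add: twmat_def vec4_eq_iff matrix_vector_mult_def sum_4 vector_4 algebra_simps)

text \<open>Quadruples list a 2 by 2 matrix row by row. In a field of even order every determinant
  is a square, so SL(2,q) already induces all of PGL(2,q).\<close>

definition sl2 :: "('a::field \<times> 'a \<times> 'a \<times> 'a) monoid" where
  "sl2 = \<lparr>carrier = {(a, b, c, d). a * d - b * c = 1},
     mult = (\<lambda>(a, b, c, d) (a', b', c', d').
       (a * a' + b * c', a * b' + b * d', c * a' + d * c', c * b' + d * d')),
     one = (1, 0, 0, 1)\<rparr>"

lemma group_sl2: "group sl2"
proof (rule groupI)
  fix x :: "'a \<times> 'a \<times> 'a \<times> 'a"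
  assume x: "x \<in> carrier sl2"
  obtain a b c d where abcd: "x = (a, b, c, d)" by (cases x)
  have ad: "a * d - b * c = 1" using x by (simp add: abcd sl2_def)
  have "(d, - b, - c, a) \<in> carrier sl2"
    using ad by (simp add: sl2_def mult.commute)
  moreover have "(d, - b, - c, a) \<otimes>\<^bsub>sl2\<^esub> x = \<one>\<^bsub>sl2\<^esub>"
    using ad by (simp add: abcd sl2_def mult.commute)
  ultimately show "\<exists>y\<in>carrier sl2. y \<otimes>\<^bsub>sl2\<^esub> x = \<one>\<^bsub>sl2\<^esub>" by blast
next
  fix x y :: "'a \<times> 'a \<times> 'a \<times> 'a"
  assume "x \<in> carrier sl2" "y \<in> carrier sl2"
  moreover have "(a * a' + b * c') * (c * b' + d * d') - (a * b' + b * d') * (c * a' + d * c')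
      = (a * d - b * c) * (a' * d' - b' * c')" for a b c d a' b' c' d' :: 'a
    by (simp add: algebra_simps)
  ultimately show "x \<otimes>\<^bsub>sl2\<^esub> y \<in> carrier sl2"
    by (clarsimp simp: sl2_def)
next
  fix x y z :: "'a \<times> 'a \<times> 'a \<times> 'a"
  show "x \<otimes>\<^bsub>sl2\<^esub> y \<otimes>\<^bsub>sl2\<^esub> z = x \<otimes>\<^bsub>sl2\<^esub> (y \<otimes>\<^bsub>sl2\<^esub> z)"
    by (cases x; cases y; cases z) (simp add: sl2_def algebra_simps)
qed (auto simp: sl2_def)

section \<open>Projective points, the polarity and the parametrized arc\<close>

lemma mem_pt_iff: "w \<in> pt v \<longleftrightarrow> (\<exists>k. w = k *s v)"
  by (auto simp: pt_def vec.span_singleton)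

lemma pt_in_PG3 [simp]: "v \<noteq> 0 \<Longrightarrow> pt v \<in> PG3"
  by (auto simp: PG3_def)

lemma PG3_cases:
  assumes "P \<in> PG3"
  obtains v where "v \<noteq> 0" "P = pt v"
  using assms by (auto simp: PG3_def)

lemma pt_scale:
  assumes "k \<noteq> 0"
  shows "pt (k *s v) = pt v"
proof -
  have "v = inverse k *s (k *s v)" using assms by simp
  then show ?thesis unfolding set_eq_iff mem_pt_iff by (metis vector_smult_assoc)
qed

lemma pt_eqD: "pt v = pt w \<Longrightarrow> \<exists>k. v = k *s w"
  by (metis mem_pt_iff vector_smult_lid)

lemma pt_eq_iff:
  assumes "v \<noteq> 0"
  shows "pt v = pt w \<longleftrightarrow> (\<exists>k. k \<noteq> 0 \<and> v = k *s w)"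
proof
  assume "pt v = pt w"
  then have "v \<in> pt w" by (metis mem_pt_iff vector_smult_lid)
  then show "\<exists>k. k \<noteq> 0 \<and> v = k *s w" using assms by (auto simp: mem_pt_iff)
qed (auto simp: pt_scale)

lemma projectivity_pt: "v \<noteq> 0 \<Longrightarrow> projectivity M (pt v) = pt (M *v v)"
  by (simp add: projectivity_def image_pt)

lemma matrix_vector_mult_inj:
  fixes M :: "'a::field ^ 4 ^ 4"
  assumes "invertible M"
  shows "inj ((*v) M)"
proof -
  obtain N where "N ** M = mat 1" using assms by (auto simp: invertible_def)
  then have "N *v (M *v v) = v" for v by (simp add: matrix_vector_mul_assoc)
  then show ?thesis by (metis injI)
qed

lemma polarity_pt: "v \<in> polarity (pt u) \<longleftrightarrow> sympl_form u v = 0"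
proof -
  have "sympl_form (k *s u) v = k * sympl_form u v" for k
    by (simp add: sympl_form_def algebra_simps)
  then show ?thesis
    unfolding polarity_def mem_Collect_eq Ball_def mem_pt_iff
    by (metis mult_zero_right vector_smult_lid)
qed

lemma pt_subset_polarity: "pt v \<subseteq> polarity (pt u) \<longleftrightarrow> sympl_form u v = 0"
proof -
  have "sympl_form u (k *s v) = k * sympl_form u v" for k
    by (simp add: sympl_form_def algebra_simps)
  then show ?thesis
    unfolding subset_iff polarity_pt mem_pt_iff
    by (metis mult_zero_right vector_smult_lid)
qed

lemma twvec_nonzero: "x \<noteq> 0 \<or> y \<noteq> 0 \<Longrightarrow> twvec h x y \<noteq> 0"
  by (auto simp: twvec_def vec4_eq_iff vector_4)

lemma twvec_scale: "twvec h (k * x) (k * y) = (frob h k * k) *s twvec h x y"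
  by (simp add: twvec_def vec4_eq_iff vector_4 frob_mult)

lemma twvec_0_1: "twvec h 0 1 = axis 4 1"
  by (simp add: twvec_def vec4_eq_iff vector_4 axis_def)

lemma twvec_1: "twvec h 1 t = vector [1, t, t ^ (2 ^ h), t ^ (2 ^ h + 1)]"
  by (simp add: twvec_def vec4_eq_iff vector_4 frob_def)

text \<open>Indexing by \<open>'a option\<close> gives each arc point exactly one parameter, so
  counting arc points or osculating planes becomes counting parameters.\<close>

definition arc_pt :: "nat \<Rightarrow> 'a::field option \<Rightarrow> ('a ^ 4) set" where
  "arc_pt h s = (case s of None \<Rightarrow> pt (twvec h 0 1) | Some t \<Rightarrow> pt (twvec h 1 t))"

lemma qarc_eq_range: "qarc h = range (arc_pt h)"
  by (force simp: qarc_def arc_pt_def twvec_0_1 twvec_1 split: option.splits)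

lemma inj_arc_pt: "inj (arc_pt h)"
proof (rule injI)
  fix s t :: "'a option"
  assume "arc_pt h s = arc_pt h t"
  then have "\<exists>k. (case s of None \<Rightarrow> twvec h 0 1 | Some t \<Rightarrow> twvec h 1 t)
      = k *s (case t of None \<Rightarrow> twvec h 0 1 | Some t \<Rightarrow> twvec h 1 t)"
    by (cases s; cases t) (simp_all add: arc_pt_def pt_eqD)
  then show "s = t"
    by (cases s; cases t) (auto simp: vec4_eq_iff twvec_def vector_4)
qed

text \<open>\<open>twvec\<close> is homogeneous with factor \<sigma>(k) k, so (x, y) can be
  normalized to (0, 1) or (1, y/x).\<close>

lemma pt_twvec_in_qarc:
  assumes "x \<noteq> 0 \<or> y \<noteq> 0"
  shows "pt (twvec h x y) \<in> qarc h"
proof (cases "x = 0")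
  case True
  then have "pt (twvec h x y) = pt (twvec h (y * 0) (y * 1))" by simp
  also have "\<dots> = arc_pt h None"
    unfolding twvec_scale using assms True by (subst pt_scale) (auto simp: arc_pt_def)
  finally show ?thesis by (auto simp: qarc_eq_range)
next
  case False
  then have "pt (twvec h x y) = pt (twvec h (x * 1) (x * (y / x)))" by simp
  also have "\<dots> = arc_pt h (Some (y / x))"
    unfolding twvec_scale using False by (subst pt_scale) (auto simp: arc_pt_def)
  finally show ?thesis by (auto simp: qarc_eq_range)
qed

lemma qarc_cases:
  assumes "P \<in> qarc h"
  obtains x y where "x \<noteq> 0 \<or> y \<noteq> 0" "P = pt (twvec h x y)"
proof -
  obtain s where "P = arc_pt h s" using assms by (auto simp: qarc_eq_range)
  then show ?thesis
    using that[of 0 1] that[of 1] by (cases s) (simp_all add: arc_pt_def)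
qed

text \<open>\<^const>\<open>None\<close> is the point at infinity of the projective line, corresponding to \<open>U\<^sub>4\<close>.\<close>

definition osc_root :: "nat \<Rightarrow> 'a::field ^ 4 \<Rightarrow> 'a option \<Rightarrow> bool" where
  "osc_root h v s = (case s of None \<Rightarrow> v $ 1 = 0
     | Some t \<Rightarrow> frob h t * (t * v $ 1 + v $ 2) + t * v $ 3 + v $ 4 = 0)"

lemma projectivity_mult_image:
  assumes "invertible N" "S \<subseteq> PG3"
  shows "projectivity (M ** N) ` S = projectivity M ` projectivity N ` S"
  using assms(2) by (force simp: projectivity_mult[OF assms(1), symmetric] compose_def)

lemma polarity_axis_4: "polarity (pt (axis 4 1)) = {v :: 'a::field ^ 4. v $ 1 = 0}"
  by (auto simp: set_eq_iff polarity_pt) (simp_all add: sympl_form_def axis_def)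

text \<open>The q^4 - 1 nonzero vectors are partitioned by the points, each of which contains q - 1
  of them. The product form avoids a division of natural numbers.\<close>

lemma card_PG3:
  "card (PG3 :: ('a::{field,finite} ^ 4) set set) * (CARD('a) - 1) = CARD('a) ^ 4 - 1"
proof -
  have "card (pt v - {0}) = CARD('a) - 1" if "v \<noteq> 0" for v :: "'a ^ 4"
  proof -
    have "pt v - {0} = (\<lambda>k. k *s v) ` (UNIV - {0})"
      using that unfolding set_eq_iff Diff_iff mem_pt_iff image_iff by (auto; metis vector_smult_lzero)
    moreover have "inj_on (\<lambda>k. k *s v) (UNIV - {0})"
      using that by (auto simp: inj_on_def)
    ultimately show ?thesis by (simp add: card_image)
  qed
  then have "(\<Sum>P\<in>PG3. card (P - {0 :: 'a ^ 4})) = card (PG3 :: ('a ^ 4) set set) * (CARD('a) - 1)"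
    by (metis (no_types, lifting) PG3_cases of_nat_id sum.cong sum_constant)
  moreover have "card (\<Union>P\<in>PG3. P - {0 :: 'a ^ 4}) = (\<Sum>P\<in>PG3. card (P - {0 :: 'a ^ 4}))"
  proof (rule card_UN_disjoint)
    show "\<forall>P\<in>PG3. \<forall>Q\<in>PG3. P \<noteq> Q \<longrightarrow> (P - {0 :: 'a ^ 4}) \<inter> (Q - {0}) = {}"
    proof (intro ballI impI, rule ccontr)
      fix P Q :: "('a ^ 4) set"
      assume PQ: "P \<in> PG3" "Q \<in> PG3" "P \<noteq> Q" "(P - {0}) \<inter> (Q - {0}) \<noteq> {}"
      obtain u w where "P = pt u" "Q = pt w" using PQ by (metis PG3_cases)
      moreover obtain x where "x \<noteq> 0" "x \<in> P" "x \<in> Q" using PQ(4) by blast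
      ultimately have "P = pt x" "Q = pt x" by (metis mem_pt_iff pt_scale vector_smult_lzero)+
      then show False using PQ(3) by simp
    qed
  qed auto
  moreover have "(\<Union>P\<in>PG3. P - {0 :: 'a ^ 4}) = UNIV - {0}"
  proof -
    have "x \<in> pt x" for x :: "'a ^ 4" by (metis mem_pt_iff vector_smult_lid)
    then show ?thesis using pt_in_PG3 by blast
  qed
  ultimately show ?thesis by (simp add: card_Diff_singleton)
qed

section \<open>The field of order 2^n: characteristic 2 and the fixed elements of \<sigma>\<close>

locale twisted_arc =
  fixes n h :: nat and ty :: "'a::{field,finite} itself"
  assumes n3: "n \<ge> 3" and cop: "coprime n h" and card_field: "CARD('a) = 2 ^ n"
begin

lemma two_eq_0: "(2::'a) = 0"
proof -
  have "CHAR('a) dvd 2 ^ n"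
    using CHAR_dvd_CARD[where ?'a = 'a] card_field by simp
  then have "of_nat (2 ^ n) = (0::'a)"
    by (simp only: of_nat_eq_0_iff_char_dvd)
  then show ?thesis by simp
qed

lemma card_field_gt_2: "CARD('a) > 2"
proof -
  have "(2::nat) ^ 1 < 2 ^ n" using n3 by (intro power_strict_increasing) auto
  then show ?thesis using card_field by simp
qed

text \<open>This and the next simplification rules normalize signs away in characteristic 2.
  \<open>add_eq_0_iff_eq\<close> turns a vanishing sum into an equation and is switched off where a
  form has to stay a sum.\<close>

lemma add_self [simp]: "x + x = (0::'a)"
  using two_eq_0 by (metis mult_2 mult_zero_left)

lemma add_self_left [simp]: "x + (x + y) = (y::'a)"
  by (simp add: add.assoc[symmetric])

lemma neg_eq [simp]: "- x = (x::'a)"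
  using add_self by (metis minus_unique)

lemma diff_eq_add [simp]: "x - y = x + (y::'a)"
  by (metis diff_conv_add_uminus neg_eq)

lemma add_eq_0_iff_eq [simp]: "x + y = 0 \<longleftrightarrow> x = (y::'a)"
  by (metis diff_eq_add right_minus_eq)

lemma frob_add: "frob k (x + y) = frob k x + frob k (y::'a)"
proof (induction k)
  case (Suc k)
  have "frob (Suc k) z = (frob k z)\<^sup>2" for z :: 'a
    by (simp add: frob_def power_mult[symmetric] mult.commute)
  moreover have "(u + w)\<^sup>2 = u\<^sup>2 + w\<^sup>2" for u w :: 'a
    by (simp add: power2_eq_square algebra_simps)
  ultimately show ?case using Suc by simp
qed (simp add: frob_def)

lemma frob_inj [simp]: "frob k x = frob k y \<longleftrightarrow> x = (y::'a)"
  by (metis add_eq_0_iff_eq frob_add frob_eq_0_iff)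

lemma frob_surj: "\<exists>x. frob k x = (y::'a)"
proof -
  have "inj (frob k :: 'a \<Rightarrow> 'a)" by (simp add: inj_def)
  then have "surj (frob k :: 'a \<Rightarrow> 'a)" by (simp add: finite_UNIV_inj_surj)
  then show ?thesis by (metis surjD)
qed

text \<open>Such an x is fixed by the powers 2^h and 2^n. Bezout gives h u = n w + 1, and comparing
  the two iterates yields x = x^2.\<close>

lemma frob_fixed:
  assumes "frob h x = (x::'a)"
  shows "x = 0 \<or> x = 1"
proof -
  have iter: "frob (k * i) x = x" if "frob k x = x" for k i
  proof (induction i)
    case (Suc i)
    have "frob (k * Suc i) x = frob k (frob (k * i) x)"
      by (simp add: frob_def power_mult[symmetric] power_add mult.commute)
    then show ?case using Suc that by simp
  qed (simp add: frob_def)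
  have n: "frob n x = x"
    using power_CARD[of x] card_field by (simp add: frob_def)
  have "h \<noteq> 0" "gcd h n = 1"
    using cop n3 by (cases "h = 0"; simp add: coprime_iff_gcd_eq_1 gcd.commute)+
  then obtain u w where "h * u = n * w + 1"
    using bezout_nat[of h n] by auto
  then have "x = frob (n * w + 1) x" using iter[OF assms, of u] by simp
  also have "\<dots> = (frob (n * w) x)\<^sup>2"
    by (simp add: frob_def power_mult[symmetric] mult.commute)
  also have "\<dots> = x\<^sup>2" using iter[OF n] by simp
  finally show ?thesis by (metis mult_cancel_right2 power2_eq_square)
qed

section \<open>The twisted tensor action and its invariant forms\<close>

lemma carrier_sl2_iff: "(a, b, c, d) \<in> carrier sl2 \<longleftrightarrow> a * d + b * c = (1::'a)"
  by (simp add: sl2_def)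

text \<open>\<sigma> is a ring homomorphism, so sending g to the Kronecker product of \<sigma>(g)
  and g is multiplicative.\<close>

lemma twmat_action:
  fixes v :: "'a ^ 4"
  shows "twmat h (g \<otimes>\<^bsub>sl2\<^esub> g') *v v = twmat h g *v (twmat h g' *v v)"
proof -
  obtain a b c d where g: "g = (a, b, c, d)" by (cases g)
  obtain a' b' c' d' where g': "g' = (a', b', c', d')" by (cases g')
  have m: "g \<otimes>\<^bsub>sl2\<^esub> g' =
      (a * a' + b * c', a * b' + b * d', c * a' + d * c', c * b' + d * d')"
    by (simp add: g g' sl2_def)
  show ?thesis
    unfolding m unfolding g g' twmat_mult_vec vec4_eq_iff vector_4 frob_add frob_mult
    by (simp add: algebra_simps)
qed

text \<open>A Kronecker product maps pure tensors to pure tensors, so the action on the arc is that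
  of g on the projective line.\<close>

lemma twmat_twvec:
  "twmat h (a, b, c, d) *v twvec h x y = twvec h (a * x + b * y) (c * x + d * (y::'a))"
  unfolding twmat_mult_vec twvec_def vec4_eq_iff vector_4 frob_add frob_mult
  by (simp add: algebra_simps)

text \<open>The form is multiplied by \<sigma>(det g) det g, which is 1.\<close>

lemma sympl_form_twmat:
  fixes u v :: "'a ^ 4"
  assumes "g \<in> carrier sl2"
  shows "sympl_form (twmat h g *v u) (twmat h g *v v) = sympl_form u v"
proof -
  obtain a b c d where g: "g = (a, b, c, d)" by (cases g)
  then have D: "a * d + b * c = 1" using assms by (simp add: carrier_sl2_iff)
  then have F: "frob h a * frob h d + frob h b * frob h c = 1"
    by (metis frob_1 frob_add frob_mult)
  have "sympl_form (twmat h g *v u) (twmat h g *v v) =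
      (frob h a * frob h d + frob h b * frob h c) * (a * d + b * c) * sympl_form u v"
    unfolding g twmat_mult_vec sympl_form_def vector_4 by (simp add: algebra_simps)
  then show ?thesis using D F by simp
qed

text \<open>The quadratic form is the determinant of V, and V becomes \<sigma>(g) V g^T, so the
  factor is again \<sigma>(det g) det g = 1.\<close>

lemma quadric_twmat:
  fixes v :: "'a ^ 4"
  assumes "g \<in> carrier sl2" and w: "w = twmat h g *v v"
  shows "w $ 1 * w $ 4 + w $ 2 * w $ 3 = v $ 1 * v $ 4 + v $ 2 * v $ 3"
proof -
  obtain a b c d where g: "g = (a, b, c, d)" by (cases g)
  then have D: "a * d + b * c = 1" using assms by (simp add: carrier_sl2_iff)
  then have F: "frob h a * frob h d + frob h b * frob h c = 1"
    by (metis frob_1 frob_add frob_mult)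
  have "w $ 1 * w $ 4 + w $ 2 * w $ 3 = (frob h a * frob h d + frob h b * frob h c)
      * (a * d + b * c) * (v $ 1 * v $ 4 + v $ 2 * v $ 3)"
    unfolding w g twmat_mult_vec vector_4 by (simp add: algebra_simps)
  then show ?thesis using D F by simp
qed

subsection \<open>Osculating planes and the action of SL(2,q)\<close>

lemma osc_root_iff: "pt v \<subseteq> polarity (arc_pt h s) \<longleftrightarrow> osc_root h v (s :: 'a option)"
  by (cases s) (simp_all add: arc_pt_def pt_subset_polarity osc_root_def sympl_form_def twvec_def
    vector_4 algebra_simps del: add_eq_0_iff_eq)

text \<open>The value is \<sigma>(D) D with D the determinant of the two parameters. It vanishes
  only for proportional parameters, so an osculating plane meets the arc only in its own
  point.\<close>

lemma sympl_form_twvec: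
  "sympl_form (twvec h x y) (twvec h z w) = (frob h x * frob h w + frob h y * frob h z) * (x * w + y * (z::'a))"
  by (simp add: sympl_form_def twvec_def vector_4 algebra_simps)

lemma inj_polarity_arc: "inj (\<lambda>s :: 'a option. polarity (arc_pt h s))"
proof (rule injI)
  fix s t :: "'a option"
  assume eq: "polarity (arc_pt h s) = polarity (arc_pt h t)"
  have "arc_pt h s \<subseteq> polarity (arc_pt h s)"
    by (cases s) (simp_all add: arc_pt_def pt_subset_polarity sympl_form_twvec)
  then have "arc_pt h s \<subseteq> polarity (arc_pt h t)" using eq by simp
  then show "s = t"
    by (cases s; cases t)
      (auto simp: arc_pt_def pt_subset_polarity sympl_form_twvec)
qed

lemma num_osculating_pt: "num_osculating h (pt v) = card {s :: 'a option. osc_root h v s}"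
proof -
  have "{\<pi> \<in> osculating_planes h. pt v \<subseteq> \<pi>}
      = (\<lambda>s. polarity (arc_pt h s)) ` {s. osc_root h v s}"
    unfolding osculating_planes_def qarc_eq_range osc_root_iff[symmetric] by blast
  then show ?thesis
    by (simp add: num_osculating_def card_image inj_on_subset[OF inj_polarity_arc])
qed

lemma card_qarc: "card (qarc h :: ('a ^ 4) set set) = 2 ^ n + 1"
  using card_field by (simp add: qarc_eq_range card_image inj_arc_pt card_UNIV_option)

lemma twmat_one: "twmat h \<one>\<^bsub>sl2\<^esub> *v v = (v :: 'a ^ 4)"
  by (simp add: sl2_def twmat_mult_vec vec4_eq_iff vector_4)

lemma twmat_mult: "twmat h (g \<otimes>\<^bsub>sl2\<^esub> g') = twmat h g ** (twmat h g' :: 'a ^ 4 ^ 4)"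
  by (simp add: matrix_eq twmat_action matrix_vector_mul_assoc[symmetric])

lemma twmat_inv:
  assumes "g \<in> carrier sl2"
  shows "twmat h (inv\<^bsub>sl2\<^esub> g) *v (twmat h g *v v) = (v :: 'a ^ 4)"
    and "twmat h g *v (twmat h (inv\<^bsub>sl2\<^esub> g) *v v) = v"
  by (simp_all add: twmat_action[symmetric] group.l_inv[OF group_sl2 assms]
    group.r_inv[OF group_sl2 assms] twmat_one)

lemma invertible_twmat:
  assumes "g \<in> carrier sl2"
  shows "invertible (twmat h g :: 'a ^ 4 ^ 4)"
proof -
  have "twmat h (inv\<^bsub>sl2\<^esub> g) ** twmat h g = (mat 1 :: 'a ^ 4 ^ 4)"
    by (simp add: matrix_eq matrix_vector_mul_assoc[symmetric] twmat_inv assms)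
  then show ?thesis by (auto simp: invertible_left_inverse)
qed

lemma twmat_qarc:
  assumes g: "g \<in> carrier sl2" and P: "(P :: ('a ^ 4) set) \<in> qarc h"
  shows "(*v) (twmat h g) ` P \<in> qarc h"
proof -
  obtain a b c d where abcd: "g = (a, b, c, d)" by (cases g)
  obtain x y where xy: "x \<noteq> 0 \<or> y \<noteq> 0" "P = pt (twvec h x y)"
    using P by (rule qarc_cases)
  have "twmat h g *v twvec h x y \<noteq> 0"
    using g xy by (intro invertible_mult_nonzero invertible_twmat twvec_nonzero)
  then have "a * x + b * y \<noteq> 0 \<or> c * x + d * y \<noteq> 0"
    unfolding abcd twmat_twvec by (auto simp: twvec_def vec4_eq_iff vector_4)
  then show ?thesis
    by (simp only: xy image_pt abcd twmat_twvec pt_twvec_in_qarc)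
qed

lemma projectivity_image_qarc:
  assumes "g \<in> carrier sl2"
  shows "projectivity (twmat h g) ` qarc h = (qarc h :: ('a ^ 4) set set)"
proof (rule endo_inj_surj)
  show "projectivity (twmat h g) ` qarc h \<subseteq> (qarc h :: ('a ^ 4) set set)"
    using twmat_qarc[OF assms] qarc_subset[of h] by (auto simp: projectivity_def)
  have "inj_on (projectivity (twmat h g)) (PG3 :: ('a ^ 4) set set)"
    using projectivity_Bij[OF invertible_twmat[OF assms]] by (auto simp: Bij_def bij_betw_def)
  then show "inj_on (projectivity (twmat h g)) (qarc h :: ('a ^ 4) set set)"
    by (rule inj_on_subset) (rule qarc_subset)
qed simp

lemma projectivity_in_arc_group:
  assumes "g \<in> carrier sl2"
  shows "projectivity (twmat h g :: 'a ^ 4 ^ 4) \<in> carrier (arc_group h)"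
  using invertible_twmat[OF assms] projectivity_image_qarc[OF assms]
  by (auto simp: arc_group_def PGL4_def)

lemma group_action_sl2:
  "group_action sl2 (PG3 :: ('a ^ 4) set set) (\<lambda>g. projectivity (twmat h g))"
proof -
  have "(\<lambda>g. projectivity (twmat h g)) \<in> hom sl2 (BijGroup (PG3 :: ('a ^ 4) set set))"
    by (auto simp: hom_def BijGroup_def projectivity_Bij invertible_twmat twmat_mult projectivity_mult)
  then show ?thesis
    by (intro group_action.intro group_hom.intro group_hom_axioms.intro group_BijGroup group_sl2)
qed

lemma polarity_twmat:
  assumes "g \<in> carrier sl2"
  shows "polarity ((*v) (twmat h g) ` S) = (*v) (twmat h g) ` polarity (S :: ('a ^ 4) set)"
proof (intro equalityI subsetI)
  fix y assume y: "y \<in> polarity ((*v) (twmat h g) ` S)"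
  define z where "z = twmat h (inv\<^bsub>sl2\<^esub> g) *v y"
  have yz: "y = twmat h g *v z" by (simp add: z_def twmat_inv assms)
  then have "z \<in> polarity S"
    using y assms by (auto simp: polarity_def sympl_form_twmat)
  then show "y \<in> (*v) (twmat h g) ` polarity S" using yz by blast
qed (use assms in \<open>auto simp: polarity_def sympl_form_twmat\<close>)

lemma sl2_transitive_qarc:
  assumes "(P :: ('a ^ 4) set) \<in> qarc h"
  obtains g where "g \<in> carrier sl2" "P = (*v) (twmat h g) ` pt (axis 4 1)"
proof -
  obtain x y where xy: "x \<noteq> 0 \<or> y \<noteq> 0" "P = pt (twvec h x y)"
    using assms by (rule qarc_cases)
  \<comment> \<open>The second column is (x, y), the image of (0, 1); the first column completes it
    to determinant 1.\<close>
  define g where "g = (if x = 0 then (inverse y, x, 0, y) else (0, x, inverse x, y))"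
  have "g \<in> carrier sl2" using xy(1) by (auto simp: g_def carrier_sl2_iff)
  moreover have "P = (*v) (twmat h g) ` pt (axis 4 1)"
    by (simp add: g_def xy(2) image_pt twvec_0_1[of h, symmetric] twmat_twvec)
  ultimately show ?thesis by (rule that)
qed

text \<open>Modulo U_4 the claim is that the affine point (p, r) lies on a secant of the curve (t,
  \<sigma>(t)). With e = t + u and t = p + l e the condition becomes (l + \<sigma>(l)) \<sigma>(e) =
  r + \<sigma>(p), which is solvable for e when l is outside the prime field.\<close>

lemma frob_pencil:
  assumes w: "(w :: 'a ^ 4) $ 1 \<noteq> 0"
  obtains t u \<alpha> \<beta> \<gamma> where "t \<noteq> u" "w = \<alpha> *s twvec h 1 t + \<beta> *s twvec h 1 u + \<gamma> *s axis 4 1"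
proof -
  define p r where "p = w $ 2 / w $ 1" and "r = w $ 3 / w $ 1"
  have pr: "w $ 2 = w $ 1 * p" "w $ 3 = w $ 1 * r" using w by (simp_all add: p_def r_def)
  have "\<exists>t u l. t \<noteq> u \<and> p = (1 + l) * t + l * u \<and> r = (1 + l) * frob h t + l * frob h u"
  proof (cases "r = frob h p")
    case True
    \<comment> \<open>The point is already on the curve, so l = 0 and any second parameter will
      do.\<close>
    then show ?thesis by (intro exI[of _ p] exI[of _ "p + 1"] exI[of _ 0]) auto
  next
    case False
    have "card {0, 1 :: 'a} < CARD('a)" using card_field_gt_2 by simp
    then have "UNIV \<noteq> {0, 1 :: 'a}" by (metis less_irrefl)
    then obtain l where l: "l \<noteq> 0" "l \<noteq> (1::'a)" by blast
    then have l': "l + frob h l \<noteq> 0" using frob_fixed[of l] by auto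
    obtain e where "frob h e = (r + frob h p) / (l + frob h l)" using frob_surj by blast
    then have er: "(l + frob h l) * frob h e = r + frob h p"
      using l' by (simp del: add_eq_0_iff_eq)
    then have "e \<noteq> 0" using False by auto
    then have "p + l * e \<noteq> p + l * e + e" by simp
    moreover have "r = (1 + l) * frob h (p + l * e) + l * frob h (p + l * e + e)"
    proof -
      have "(1 + l) * frob h (p + l * e) + l * frob h (p + l * e + e)
          = frob h p + (l + frob h l) * frob h e"
        by (simp add: frob_add frob_mult algebra_simps)
      also have "\<dots> = r" unfolding er by (simp add: ac_simps)
      finally show ?thesis by simp
    qed
    moreover have "p = (1 + l) * (p + l * e) + l * (p + l * e + e)"
      by (simp add: algebra_simps)
    ultimately show ?thesis by blast
  qed
  then obtain t u l where tul: "t \<noteq> u" "p = (1 + l) * t + l * u" "r = (1 + l) * frob h t + l * frob h u"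
    by blast
  define \<alpha> \<beta> where "\<alpha> = w $ 1 * (1 + l)" and "\<beta> = w $ 1 * l"
  \<comment> \<open>The multiple of U_4 absorbs the error in the fourth coordinate.\<close>
  define \<gamma> where "\<gamma> = w $ 4 + \<alpha> * (frob h t * t) + \<beta> * (frob h u * u)"
  have "w = \<alpha> *s twvec h 1 t + \<beta> *s twvec h 1 u + \<gamma> *s axis 4 1"
    unfolding vec4_eq_iff
    by (simp add: pr tul(2,3) twvec_def vector_4 axis_def \<gamma>_def \<alpha>_def \<beta>_def algebra_simps)
  then show ?thesis using that tul(1) by blast
qed

subsection \<open>The stabilizer of the arc permutes the osculating planes\<close>

text \<open>Otherwise the image of u lies on a secant modulo U_4, and pulling back by K puts u on
  one too. As the first coordinate of u is 0, its second and third coordinates are then s (t' + r')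
  and s \<sigma>(t' + r') for some s: both zero or both nonzero, unlike those of u.\<close>

lemma arc_stab_tangent:
  fixes K :: "'a ^ 4 ^ 4"
  assumes K: "invertible K" "projectivity K ` qarc h = qarc h"
    and fix4: "K *v axis 4 1 \<in> pt (axis 4 1)"
    and u: "u = axis 2 1 \<or> u = axis 3 1"
  shows "(K *v u) $ 1 = 0"
proof (rule ccontr)
  assume "(K *v u) $ 1 \<noteq> 0"
  then obtain t r \<alpha> \<beta> \<gamma> where tr: "t \<noteq> r"
    and w: "K *v u = \<alpha> *s twvec h 1 t + \<beta> *s twvec h 1 r + \<gamma> *s axis 4 1"
    by (rule frob_pencil)
  obtain \<kappa> where \<kappa>: "K *v axis 4 1 = \<kappa> *s axis 4 1" using fix4 by (auto simp: mem_pt_iff)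
  have "\<kappa> \<noteq> 0"
  proof
    assume "\<kappa> = 0"
    then have "K *v axis 4 1 = 0" using \<kappa> by simp
    moreover have "axis 4 1 \<noteq> (0 :: 'a ^ 4)" by (simp add: axis_eq_0_iff)
    ultimately show False using invertible_mult_nonzero[OF K(1)] by blast
  qed
  \<comment> \<open>K fixes U_4, so the preimage of an affine arc point cannot be U_4 and is affine
    as well.\<close>
  have pre: "\<exists>t' k. k \<noteq> 0 \<and> twvec h 1 t = k *s (K *v twvec h 1 t')" for t
  proof -
    have "arc_pt h (Some t) \<in> projectivity K ` qarc h" unfolding K(2) by (simp add: qarc_eq_range)
    then obtain s where s: "arc_pt h (Some t) = projectivity K (arc_pt h s)"
      by (auto simp: qarc_eq_range)
    have "s \<noteq> None"
    proof
      assume "s = None"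
      then have "arc_pt h (Some t) = pt (\<kappa> *s twvec h 0 1)"
        using s \<kappa> by (simp add: arc_pt_def projectivity_pt twvec_nonzero twvec_0_1 axis_eq_0_iff)
      also have "\<dots> = arc_pt h None" using \<open>\<kappa> \<noteq> 0\<close> by (simp add: pt_scale arc_pt_def)
      finally show False using inj_arc_pt by (metis injD option.distinct(1))
    qed
    then obtain t' where "s = Some t'" by blast
    then have "pt (twvec h 1 t) = pt (K *v twvec h 1 t')"
      using s by (simp add: arc_pt_def projectivity_pt twvec_nonzero)
    then show ?thesis using pt_eq_iff[OF twvec_nonzero] by (metis zero_neq_one)
  qed
  obtain t' k where t': "k \<noteq> 0" "twvec h 1 t = k *s (K *v twvec h 1 t')" using pre by blast
  obtain r' l where r': "l \<noteq> 0" "twvec h 1 r = l *s (K *v twvec h 1 r')" using pre by blast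
  define v where "v = (\<alpha> * k) *s twvec h 1 t' + (\<beta> * l) *s twvec h 1 r' + (\<gamma> / \<kappa>) *s axis 4 1"
  have "K *v u = K *v v"
    unfolding w t'(2) r'(2) v_def
    using \<open>\<kappa> \<noteq> 0\<close> by (simp add: matrix_vector_right_distrib vec.scale \<kappa> vector_smult_assoc)
  then have "u = v" using matrix_vector_mult_inj[OF K(1)] by (simp add: inj_eq)
  then have 1: "u $ 1 = \<alpha> * k + \<beta> * l" and 2: "u $ 2 = \<alpha> * k * t' + \<beta> * l * r'"
    and 3: "u $ 3 = \<alpha> * k * frob h t' + \<beta> * l * frob h r'"
    by (simp_all add: v_def twvec_def vector_4 axis_def)
  have "u $ 1 = 0" using u by (auto simp: axis_def)
  then have kl: "\<beta> * l = \<alpha> * k" using 1 by auto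
  have "u $ 2 = \<alpha> * k * (t' + r')" "u $ 3 = \<alpha> * k * frob h (t' + r')"
    using 2 3 by (simp_all add: kl frob_add algebra_simps)
  then show False using u by (auto simp: axis_def)
qed

text \<open>Modulo \<open>U\<^sub>4\<close> the two lines of the quadric through \<open>U\<^sub>4\<close> are the only ones that miss every
  secant of the arc, so a projectivity fixing \<open>U\<^sub>4\<close> and the arc fixes the plane they span.\<close>

lemma arc_stab_axis_4:
  fixes K :: "'a ^ 4 ^ 4"
  assumes K: "invertible K" "projectivity K ` qarc h = qarc h"
    and fix4: "K *v axis 4 1 \<in> pt (axis 4 1)"
  shows "(*v) K ` polarity (pt (axis 4 1)) = polarity (pt (axis 4 1))"
proof (rule endo_inj_surj)
  show "(*v) K ` polarity (pt (axis 4 1)) \<subseteq> polarity (pt (axis 4 1))"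
    unfolding polarity_axis_4
  proof (clarify)
    fix v :: "'a ^ 4" assume "v $ 1 = 0"
    then have v: "v = v $ 2 *s axis 2 1 + v $ 3 *s axis 3 1 + v $ 4 *s axis 4 1"
      by (simp add: vec4_eq_iff axis_def)
    have "(K *v axis 4 1) $ 1 = 0" using fix4 by (auto simp: mem_pt_iff axis_def)
    moreover have "(K *v axis 2 1) $ 1 = 0" "(K *v axis 3 1) $ 1 = 0"
      using arc_stab_tangent[OF assms] by blast+
    ultimately show "(K *v v) $ 1 = 0"
      by (subst v) (simp add: matrix_vector_right_distrib vec.scale)
  qed
  show "inj_on ((*v) K) (polarity (pt (axis 4 1)))"
    using matrix_vector_mult_inj[OF K(1)] by (rule inj_on_subset) simp
qed simp

text \<open>M is not assumed to respect the symplectic form. Transitivity on the arc moves both P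
  and its image to U_4, and the resulting K fixes U_4 and the arc, so \<open>arc_stab_axis_4\<close>
  applies; the two matrices from SL(2,q) do preserve the form.\<close>

lemma polarity_arc_stab:
  fixes M :: "'a ^ 4 ^ 4"
  assumes M: "invertible M" "projectivity M ` qarc h = qarc h" and P: "P \<in> qarc h"
  shows "(*v) M ` polarity P = polarity ((*v) M ` P)"
proof -
  have MP: "(*v) M ` P \<in> qarc h"
    using M(2) P qarc_subset[of h] by (force simp: projectivity_def)
  obtain g where g: "g \<in> carrier sl2" "P = (*v) (twmat h g) ` pt (axis 4 1)"
    using P by (rule sl2_transitive_qarc)
  obtain g' where g': "g' \<in> carrier sl2" "(*v) M ` P = (*v) (twmat h g') ` pt (axis 4 1)"
    using MP by (rule sl2_transitive_qarc)
  define K where "K = twmat h (inv\<^bsub>sl2\<^esub> g') ** (M ** twmat h g)"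
  have i: "inv\<^bsub>sl2\<^esub> g' \<in> carrier sl2" using g'(1) by (simp add: group.inv_closed[OF group_sl2])
  have inv2: "invertible (M ** twmat h g)" using M(1) g(1) by (simp add: invertible_mult invertible_twmat)
  then have K1: "invertible K" unfolding K_def using i by (simp add: invertible_mult invertible_twmat)
  have K2: "projectivity K ` qarc h = qarc h"
    unfolding K_def projectivity_mult_image[OF inv2 qarc_subset]
      projectivity_mult_image[OF invertible_twmat[OF g(1)] qarc_subset]
    by (simp only: projectivity_image_qarc g(1) M(2) i)
  have K: "twmat h g' *v (K *v v) = M *v (twmat h g *v v)" for v
    unfolding K_def by (simp only: matrix_vector_mul_assoc[symmetric] twmat_inv g'(1))
  have "axis 4 1 \<in> pt (axis 4 (1::'a))" by (metis mem_pt_iff vector_smult_lid)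
  then have "M *v (twmat h g *v axis 4 1) \<in> (*v) (twmat h g') ` pt (axis 4 1)"
    unfolding g'(2)[symmetric] g(2) by blast
  then obtain z where z: "z \<in> pt (axis 4 1)" "twmat h g' *v (K *v axis 4 1) = twmat h g' *v z"
    unfolding K by blast
  then have "K *v axis 4 1 = z"
    using matrix_vector_mult_inj[OF invertible_twmat[OF g'(1)]] by (simp add: inj_eq)
  then have K3: "(*v) K ` polarity (pt (axis 4 1)) = polarity (pt (axis 4 1))"
    using arc_stab_axis_4[OF K1 K2] z by simp
  have "(*v) M ` polarity P = (*v) M ` (*v) (twmat h g) ` polarity (pt (axis 4 1))"
    by (simp only: g polarity_twmat)
  also have "\<dots> = (*v) (twmat h g') ` (*v) K ` polarity (pt (axis 4 1))"
    by (simp only: image_image K)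
  also have "\<dots> = polarity ((*v) M ` P)"
    by (simp only: K3 g' polarity_twmat)
  finally show ?thesis .
qed

text \<open>g maps the osculating planes through P injectively to those through its image. Applied
  to the inverse of g, this bound becomes an equality.\<close>

lemma num_osculating_le:
  fixes P :: "('a ^ 4) set"
  assumes g: "g \<in> carrier (arc_group h)" and P: "P \<in> PG3"
  shows "num_osculating h P \<le> num_osculating h (g P)"
proof -
  obtain M where M: "g = projectivity M" "invertible M" "projectivity M ` qarc h = qarc h"
    using g by (auto simp: arc_group_def PGL4_def)
  have gP: "g P = (*v) M ` P" using P by (simp add: M(1) projectivity_def)
  have "(*v) M ` \<pi> \<in> osculating_planes h" if "\<pi> \<in> osculating_planes h" for \<pi>
  proof -
    obtain X where X: "X \<in> qarc h" "\<pi> = polarity X" using \<open>\<pi> \<in> _\<close> by (auto simp: osculating_planes_def)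
    have "(*v) M ` X \<in> qarc h"
      using M(3) X(1) qarc_subset[of h] by (force simp: projectivity_def)
    then show ?thesis using polarity_arc_stab[OF M(2,3) X(1)] X(2) by (auto simp: osculating_planes_def)
  qed
  then have "(`) ((*v) M) ` {\<pi> \<in> osculating_planes h. P \<subseteq> \<pi>}
      \<subseteq> {\<pi> \<in> osculating_planes h. (*v) M ` P \<subseteq> \<pi>}"
    by blast
  moreover have "inj_on ((`) ((*v) M)) {\<pi> \<in> osculating_planes h. P \<subseteq> \<pi>}"
    by (rule inj_onI) (simp add: inj_image_eq_iff[OF matrix_vector_mult_inj[OF M(2)]])
  ultimately show ?thesis
    unfolding num_osculating_def gP by (intro card_inj_on_le) simp_all
qed

lemma num_osculating_arc_group:
  fixes P :: "('a ^ 4) set"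
  assumes g: "g \<in> carrier (arc_group h)" and P: "P \<in> PG3"
  shows "num_osculating h (g P) = num_osculating h P"
proof (rule antisym)
  have act: "group_action (arc_group h) (PG3 :: ('a ^ 4) set set) (\<lambda>g. g)"
    by (rule group_action_arc_group)
  have grp: "group (arc_group h :: (('a ^ 4) set \<Rightarrow> ('a ^ 4) set) monoid)"
    by (rule group_hom.axioms(1)[OF group_action.group_hom[OF act]])
  have "inv\<^bsub>arc_group h\<^esub> g \<in> carrier (arc_group h)"
    by (rule group.inv_closed[OF grp g])
  moreover have "(inv\<^bsub>arc_group h\<^esub> g) (g P) = P"
    using group_action.orbit_sym_aux[OF act g P refl] .
  moreover have "g P \<in> PG3" using group_action.element_image[OF act g P refl] .
  ultimately show "num_osculating h (g P) \<le> num_osculating h P"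
    using num_osculating_le by metis
qed (use assms in \<open>rule num_osculating_le\<close>)

section \<open>Orbits of SL(2,q) on the points\<close>

abbreviation sl2_orbit :: "('a ^ 4) set \<Rightarrow> ('a ^ 4) set set" where
  "sl2_orbit \<equiv> orbit sl2 (\<lambda>g. projectivity (twmat h g))"

interpretation sl2: group_action sl2 "PG3 :: ('a ^ 4) set set" "\<lambda>g. projectivity (twmat h g)"
  by (rule group_action_sl2)

lemma sl2_orbit_memI:
  assumes "v \<noteq> 0" "g \<in> carrier sl2" "k \<noteq> 0" "twmat h g *v v = k *s w"
  shows "pt w \<in> sl2_orbit (pt v)"
proof -
  have "projectivity (twmat h g) (pt v) = pt w"
    using assms by (simp add: projectivity_pt pt_scale)
  then show ?thesis using assms(2) unfolding orbit_def by (metis (mono_tags, lifting) mem_Collect_eq)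
qed

lemma sl2_orbit_subset: "P \<in> PG3 \<Longrightarrow> sl2_orbit P \<subseteq> PG3"
  using sl2.element_image by (auto simp: orbit_def)

lemma sl2_orbit_num:
  assumes "P \<in> PG3" "Q \<in> sl2_orbit P"
  shows "num_osculating h Q = num_osculating h P"
  using assms num_osculating_arc_group[OF projectivity_in_arc_group] by (auto simp: orbit_def)

lemma sl2_orbit_eq:
  assumes "P \<in> PG3" "Q \<in> sl2_orbit P"
  shows "sl2_orbit Q = sl2_orbit P"
proof -
  have Q: "Q \<in> PG3" using assms sl2_orbit_subset by blast
  show ?thesis
    using assms Q sl2_orbit_subset sl2.orbit_trans sl2.orbit_sym by (meson subset_antisym subsetI subsetD)
qed

subsection \<open>Normal forms of the points on osculating planes\<close>

text \<open>The quotient \<sigma>(a)/a is injective on nonzero elements, because \<sigma> fixes no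
  nonzero element but 1; finiteness makes it surjective.\<close>

lemma frob_quotient_surj:
  assumes "y \<noteq> (0::'a)"
  shows "\<exists>a. a \<noteq> 0 \<and> frob h a = a * y"
proof -
  let ?f = "\<lambda>a :: 'a. frob h a / a"
  have "inj_on ?f (UNIV - {0})"
  proof (rule inj_onI)
    fix a b :: 'a assume ab: "a \<in> UNIV - {0}" "b \<in> UNIV - {0}" "frob h a / a = frob h b / b"
    then have "frob h (a / b) = a / b" by (simp add: frob_divide field_simps)
    then show "a = b" using frob_fixed ab(1,2) by fastforce
  qed
  moreover have "?f ` (UNIV - {0}) \<subseteq> UNIV - {0}" by auto
  ultimately have "?f ` (UNIV - {0}) = UNIV - {0}" by (intro endo_inj_surj) auto
  then obtain a where "a \<noteq> 0" "y = frob h a / a" using assms by blast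
  then show ?thesis by (intro exI[of _ a]) simp
qed

text \<open>The image of an additive map with kernel {0, 1}, hence a subgroup of index 2. The point
  \<open>orbit_rep 1 e\<close> has a finite root exactly when e lies in it.\<close>

definition artin_schreier_image :: "'a set" where
  "artin_schreier_image = range (\<lambda>t. frob h t + t)"

text \<open>The map takes the same value at 0 and 1, so on a finite set it cannot be onto.\<close>

lemma artin_schreier_image_neq_UNIV: "artin_schreier_image \<noteq> UNIV"
proof
  assume "artin_schreier_image = UNIV"
  then have "inj (\<lambda>t :: 'a. frob h t + t)"
    unfolding artin_schreier_image_def by (intro finite_UNIV_surj_inj) auto
  then have "(0::'a) = 1" by (rule injD) simp
  then show False by simp
qed

text \<open>The kernel has at most two elements, so the image has at least q/2. The image and its
  coset through e are disjoint and therefore cover the field.\<close>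

lemma artin_schreier_image_coset:
  assumes "e \<notin> artin_schreier_image" "e' \<notin> artin_schreier_image"
  shows "\<exists>c. e + e' = frob h c + c"
proof -
  define L where "L = (\<lambda>t :: 'a. frob h t + t)"
  have add: "L (x + y) = L x + L y" for x y by (simp add: L_def frob_add ac_simps)
  have ker: "x = 0 \<or> x = 1" if "L x = 0" for x using that frob_fixed by (simp add: L_def)
  have im: "artin_schreier_image = range L" by (simp add: artin_schreier_image_def L_def)
  \<comment> \<open>Every x is a chosen preimage of L x plus a kernel element, which bounds q by
    twice the size of the image.\<close>
  have "x \<in> (\<lambda>(y, d). inv_into UNIV L y + d) ` (range L \<times> {0, 1})" for x
  proof -
    have "L (inv_into UNIV L (L x) + x) = 0" by (simp add: add f_inv_into_f)
    then have "inv_into UNIV L (L x) + x \<in> {0, 1}" using ker by blast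
    then show ?thesis
      by (intro image_eqI[where x = "(L x, inv_into UNIV L (L x) + x)"]) simp_all
  qed
  then have "UNIV \<subseteq> (\<lambda>(y, d). inv_into UNIV L y + d) ` (range L \<times> {0, 1})" by blast
  then have "CARD('a) \<le> card (range L \<times> {0, 1 :: 'a})"
    by (meson card_image_le card_mono finite finite_imageI le_trans)
  then have q: "CARD('a) \<le> 2 * card (range L)" by (simp add: card_cartesian_product)
  have disj: "(\<lambda>y. e + y) ` range L \<inter> range L = {}"
  proof (rule ccontr)
    assume "(\<lambda>y. e + y) ` range L \<inter> range L \<noteq> {}"
    then obtain x y where "e + L x = L y" by blast
    then have "e = L (x + y)" by (metis add add.commute add_self_left)
    then show False using assms(1) im by blast
  qed
  have "card ((\<lambda>y. e + y) ` range L \<union> range L) = 2 * card (range L)"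
    using disj by (simp add: card_Un_disjoint card_image)
  then have "(\<lambda>y. e + y) ` range L \<union> range L = UNIV"
    using q by (intro card_seteq) auto
  then have "e' \<in> (\<lambda>y. e + y) ` range L" using assms(2) im by blast
  then obtain c where "e' = e + L c" by blast
  then have "e + e' = frob h c + c" by (simp add: L_def)
  then show ?thesis ..
qed

text \<open>A point whose osculating planes other than \<open>X\<^sub>1 = 0\<close> correspond to the zeros of \<open>\<sigma>(t) + c t + e\<close>.\<close>

definition orbit_rep :: "'a \<Rightarrow> 'a \<Rightarrow> 'a ^ 4" where
  "orbit_rep c e = vector [0, 1, c, e]"

lemma orbit_rep_nth [simp]: "orbit_rep c e $ 1 = 0" "orbit_rep c e $ 2 = 1" "orbit_rep c e $ 3 = c" "orbit_rep c e $ 4 = e"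
  by (simp_all add: orbit_rep_def vector_4)

lemma orbit_rep_nonzero [simp]: "orbit_rep c e \<noteq> 0"
  by (metis orbit_rep_nth(2) zero_index zero_neq_one)

lemma sl2_orbit_root_infinity:
  assumes v: "v \<noteq> 0" and s: "osc_root h v (s :: 'a option)"
  obtains w where "w \<noteq> 0" "w $ 1 = 0" "pt w \<in> sl2_orbit (pt v)"
proof (cases s)
  case None
  then show ?thesis
    using that[of v] s v sl2.orbit_refl[OF pt_in_PG3[OF v]] by (simp add: osc_root_def)
next
  case (Some t)
  \<comment> \<open>The new first coordinate is the osculating form evaluated at the first row (t,
    1) of g.\<close>
  define g where "g = (t, 1 :: 'a, 1 :: 'a, 0 :: 'a)"
  have g: "g \<in> carrier sl2" by (simp add: g_def carrier_sl2_iff)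
  define w where "w = twmat h g *v v"
  have "w \<noteq> 0" unfolding w_def using g v by (intro invertible_mult_nonzero invertible_twmat)
  moreover have "w $ 1 = 0"
    using s Some by (simp add: w_def g_def twmat_mult_vec vector_4 osc_root_def algebra_simps
        del: add_eq_0_iff_eq)
  moreover have "pt w \<in> sl2_orbit (pt v)"
    using sl2_orbit_memI[OF v g, of 1] by (simp add: w_def)
  ultimately show ?thesis by (rule that)
qed

lemma sl2_orbit_root_zero:
  assumes v: "v \<noteq> 0" "v $ 1 = 0" and t: "osc_root h v (Some (t :: 'a))"
  obtains w where "w \<noteq> 0" "w $ 1 = 0" "w $ 4 = 0" "pt w \<in> sl2_orbit (pt v)"
proof -
  \<comment> \<open>The new fourth coordinate is the osculating form at the second row (t, 1); the
    first coordinate stays 0.\<close>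
  define g where "g = (1 :: 'a, 0 :: 'a, t, 1 :: 'a)"
  have g: "g \<in> carrier sl2" by (simp add: g_def carrier_sl2_iff)
  define w where "w = twmat h g *v v"
  have "w \<noteq> 0" unfolding w_def using g v by (intro invertible_mult_nonzero invertible_twmat)
  moreover have "w $ 1 = 0" using v(2) by (simp add: w_def g_def twmat_mult_vec vector_4)
  moreover have "w $ 4 = 0"
    using t v(2) by (simp add: w_def g_def twmat_mult_vec vector_4 osc_root_def algebra_simps
        del: add_eq_0_iff_eq)
  moreover have "pt w \<in> sl2_orbit (pt v)"
    using sl2_orbit_memI[OF v(1) g, of 1] by (simp add: w_def)
  ultimately show ?thesis by (rule that)
qed

text \<open>A diagonal matrix with entries a and 1/a multiplies the second coordinate by
  \<sigma>(a)/a and the third by its inverse. They become equal when \<sigma>(a)/a is a square root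
  of the quotient of third by second coordinate.\<close>

lemma sl2_orbit_rep_1:
  assumes v: "v $ 1 = 0" "v $ 2 \<noteq> 0" "v $ 3 \<noteq> (0 :: 'a)"
  obtains e where "pt (orbit_rep 1 e) \<in> sl2_orbit (pt v)" "v $ 4 = 0 \<longrightarrow> e = 0"
proof -
  \<comment> \<open>\<open>frob 1\<close> is squaring, so y is the required square root.\<close>
  obtain y where "frob 1 y = v $ 3 / v $ 2" using frob_surj by blast
  then have y: "y * y * v $ 2 = v $ 3" using v by (simp add: frob_def power2_eq_square)
  then have "y \<noteq> 0" using v by auto
  then obtain a where a: "a \<noteq> 0" "frob h a = a * y" using frob_quotient_surj by blast
  define b where "b = inverse a"
  have ab: "a * b = 1" "frob h b * (a * y) = 1"
    using a frob_mult[of h b a] by (simp_all add: b_def)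
  define g where "g = (a, 0 :: 'a, 0 :: 'a, b)"
  have g: "g \<in> carrier sl2" using ab by (simp add: g_def carrier_sl2_iff)
  define k where "k = y * v $ 2"
  define e where "e = frob h b * b * v $ 4 / k"
  have "k \<noteq> 0" using \<open>y \<noteq> 0\<close> v by (simp add: k_def)
  moreover have "twmat h g *v v = k *s orbit_rep 1 e"
  proof -
    have "frob h a * (b * v $ 2) = (a * b) * k" by (simp add: a(2) k_def ac_simps)
    then have 2: "frob h a * (b * v $ 2) = k" by (simp only: ab mult_1)
    have "frob h b * (a * v $ 3) = (frob h b * (a * y)) * k"
      by (simp add: y[symmetric] k_def ac_simps)
    then have 3: "frob h b * (a * v $ 3) = k" by (simp only: ab mult_1)
    show ?thesis
      unfolding vec4_eq_iff using v(1) \<open>k \<noteq> 0\<close>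
      by (simp add: g_def twmat_mult_vec vector_4 e_def 2 3)
  qed
  moreover have "v \<noteq> 0" using v by auto
  ultimately have "pt (orbit_rep 1 e) \<in> sl2_orbit (pt v)" using sl2_orbit_memI[OF _ g] by blast
  then show ?thesis using that by (simp add: e_def)
qed

lemma sl2_orbit_cases:
  assumes v: "(v :: 'a ^ 4) \<noteq> 0" and e0: "e0 \<notin> artin_schreier_image"
    and root: "osc_root h v s"
  shows "pt v \<in> qarc h \<or> pt v \<in> sl2_orbit (pt (orbit_rep 0 0)) \<or> pt v \<in> sl2_orbit (pt (orbit_rep 1 0))
    \<or> pt v \<in> sl2_orbit (pt (orbit_rep 1 e0))"
proof -
  have lift: "pt u \<in> sl2_orbit (pt v)" if "w \<noteq> 0" "pt u \<in> sl2_orbit (pt w)" "pt w \<in> sl2_orbit (pt v)" for u w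
    using that v sl2_orbit_eq[of "pt v" "pt w"] by simp
  have sym: "pt v \<in> sl2_orbit (pt u)" if "u \<noteq> 0" "pt u \<in> sl2_orbit (pt v)" for u
    by (rule sl2.orbit_sym) (use that v in simp_all)
  obtain w where w: "w \<noteq> 0" "w $ 1 = 0" "pt w \<in> sl2_orbit (pt v)"
    using sl2_orbit_root_infinity[OF v root] .
  show ?thesis
  proof (cases "\<exists>t. osc_root h w (Some t)")
    case True
    then obtain t where "osc_root h w (Some t)" ..
    then obtain z where z: "z \<noteq> 0" "z $ 1 = 0" "z $ 4 = 0" "pt z \<in> sl2_orbit (pt w)"
      using sl2_orbit_root_zero[OF w(1,2)] by blast
    have zv: "pt z \<in> sl2_orbit (pt v)" using lift w z by blast
    consider "z $ 3 = 0" | "z $ 2 = 0" | "z $ 2 \<noteq> 0" "z $ 3 \<noteq> 0" by blast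
    then show ?thesis
    proof cases
      case 1
      then have "z $ 2 \<noteq> 0" "z = z $ 2 *s orbit_rep 0 0" using z by (auto simp: vec4_eq_iff)
      then have "pt z = pt (orbit_rep 0 0)" by (metis pt_scale)
      then show ?thesis using zv sym by simp
    next
      case 2
      \<comment> \<open>This swaps the roots 0 and infinity, and with them the second and third
        coordinates.\<close>
      define g where "g = (0 :: 'a, 1 :: 'a, 1 :: 'a, 0 :: 'a)"
      have g: "g \<in> carrier sl2" by (simp add: g_def carrier_sl2_iff)
      have "z $ 3 \<noteq> 0" using z 2 by (auto simp: vec4_eq_iff)
      moreover have "twmat h g *v z = z $ 3 *s orbit_rep 0 0"
        using z 2 by (simp add: vec4_eq_iff g_def twmat_mult_vec vector_4)
      ultimately have "pt (orbit_rep 0 0) \<in> sl2_orbit (pt z)" using sl2_orbit_memI[OF z(1) g] by blast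
      then show ?thesis using lift zv z(1) sym by (metis orbit_rep_nonzero)
    next
      case 3
      then obtain e where "pt (orbit_rep 1 e) \<in> sl2_orbit (pt z)" "z $ 4 = 0 \<longrightarrow> e = 0"
        using sl2_orbit_rep_1[OF z(2)] by metis
      then show ?thesis using lift zv z(1,3) sym by (metis orbit_rep_nonzero)
    qed
  next
    case False
    \<comment> \<open>If just one of these coordinates vanished, the remaining equation in
      \<sigma>(t) or in t would have a finite solution.\<close>
    have w23: "w $ 2 = 0 \<longleftrightarrow> w $ 3 = 0"
    proof (rule ccontr)
      assume *: "\<not> ?thesis"
      obtain t where t: "frob h t = w $ 4 / w $ 2" using frob_surj by blast
      show False
        using * False[simplified, rule_format, of t] False[simplified, rule_format, of "w $ 4 / w $ 3"] t w(2)
        by (auto simp: osc_root_def)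
    qed
    show ?thesis
    proof (cases "w $ 2 = 0")
      case True
      then have "w = w $ 4 *s axis 4 1" "w $ 4 \<noteq> 0" using w w23 by (auto simp: vec4_eq_iff axis_def)
      then have "pt w = pt (twvec h 0 1)" unfolding twvec_0_1 by (metis pt_scale)
      then have "pt w \<in> qarc h" by (simp add: pt_twvec_in_qarc)
      moreover obtain g where "g \<in> carrier sl2" "pt v = (*v) (twmat h g) ` pt w"
        using sl2.orbit_sym[OF _ _ w(3)] v w(1) by (auto simp: orbit_def projectivity_def)
      ultimately show ?thesis using twmat_qarc by metis
    next
      case nz: False
      obtain e where e: "pt (orbit_rep 1 e) \<in> sl2_orbit (pt w)"
        using sl2_orbit_rep_1[OF w(2)] nz w23 by metis
      \<comment> \<open>A finite root would give a second osculating plane, but w has only the one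
        at infinity and the number is constant on the orbit.\<close>
      have "e \<notin> artin_schreier_image"
      proof
        assume "e \<in> artin_schreier_image"
        then obtain t where "e = frob h t + t" by (auto simp: artin_schreier_image_def)
        then have "{None, Some t} \<subseteq> {s. osc_root h (orbit_rep 1 e) s}" by (simp add: osc_root_def)
        then have "card {None, Some t} \<le> num_osculating h (pt (orbit_rep 1 e))"
          unfolding num_osculating_pt by (rule card_mono[rotated]) simp
        moreover have "{s. osc_root h w s} = {None}"
        proof (rule Set.set_eqI)
          fix s show "s \<in> {s. osc_root h w s} \<longleftrightarrow> s \<in> {None}"
            using False w(2) by (cases s) (simp_all add: osc_root_def)
        qed
        then have "num_osculating h (pt w) = 1" by (simp add: num_osculating_pt)
        ultimately show False using sl2_orbit_num[OF _ e] w(1) by simp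
      qed
      then obtain c where c: "e + e0 = frob h c + c" using artin_schreier_image_coset e0 by blast
      \<comment> \<open>Translation by c adds \<sigma>(c) + c to the last coordinate, turning e into
        e0.\<close>
      define g where "g = (1 :: 'a, 0 :: 'a, c, 1 :: 'a)"
      have g: "g \<in> carrier sl2" by (simp add: g_def carrier_sl2_iff)
      have "e0 = frob h c + c + e" unfolding c[symmetric] by (simp add: ac_simps)
      then have "twmat h g *v orbit_rep 1 e = 1 *s orbit_rep 1 e0"
        by (simp add: vec4_eq_iff g_def twmat_mult_vec vector_4 ac_simps)
      then have "pt (orbit_rep 1 e0) \<in> sl2_orbit (pt (orbit_rep 1 e))" using sl2_orbit_memI[OF _ g, of _ 1] by simp
      then show ?thesis using e lift w sym by (metis orbit_rep_nonzero)
    qed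
  qed
qed

subsection \<open>Stabilizers\<close>

lemma qarc_eq_orbit: "qarc h = sl2_orbit (pt (axis 4 1))"
proof
  have nz: "axis 4 1 \<noteq> (0 :: 'a ^ 4)" by (simp add: axis_eq_0_iff)
  have A: "pt (axis 4 1) \<in> (qarc h :: ('a ^ 4) set set)" by (simp add: qarc_def)
  show "qarc h \<subseteq> sl2_orbit (pt (axis 4 1))"
  proof
    fix P :: "('a ^ 4) set" assume "P \<in> qarc h"
    then obtain g where g: "g \<in> carrier sl2" "P = (*v) (twmat h g) ` pt (axis 4 1)"
      by (rule sl2_transitive_qarc)
    then have "P = projectivity (twmat h g) (pt (axis 4 1))"
      by (simp add: image_pt projectivity_pt nz)
    then show "P \<in> sl2_orbit (pt (axis 4 1))" using g(1) unfolding orbit_def by blast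
  qed
  show "sl2_orbit (pt (axis 4 1)) \<subseteq> qarc h"
    using twmat_qarc A nz by (auto simp: orbit_def projectivity_def)
qed

lemma num_osculating_qarc:
  assumes "P \<in> qarc h"
  shows "num_osculating h (P :: ('a ^ 4) set) = 1"
proof -
  have "{s. osc_root h (axis 4 (1 :: 'a)) s} = {None}"
    by (auto simp: osc_root_def axis_def split: option.splits)
  then have "num_osculating h (pt (axis 4 (1 :: 'a))) = 1" by (simp add: num_osculating_pt)
  then show ?thesis
    using assms sl2_orbit_num[of "pt (axis 4 1)"] by (simp add: qarc_eq_orbit axis_eq_0_iff)
qed

lemma num_osculating_rep_0_0: "num_osculating h (pt (orbit_rep 0 0)) = 2"
proof -
  have "{s. osc_root h (orbit_rep 0 0) s} = {None, Some 0}"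
    by (auto simp: osc_root_def split: option.splits)
  then show ?thesis by (simp add: num_osculating_pt)
qed

lemma num_osculating_rep_1_0: "num_osculating h (pt (orbit_rep 1 0)) = 3"
proof -
  have "{s. osc_root h (orbit_rep 1 0) s} = {None, Some 0, Some 1}"
    using frob_fixed by (auto simp: osc_root_def split: option.splits)
  then show ?thesis by (simp add: num_osculating_pt)
qed

lemma num_osculating_rep_1:
  assumes "e \<notin> artin_schreier_image"
  shows "num_osculating h (pt (orbit_rep 1 e)) = 1"
proof -
  have "frob h t + t + e \<noteq> 0" for t
    using assms by (auto simp: artin_schreier_image_def)
  then have "{s. osc_root h (orbit_rep 1 e) s} = {None}"
    by (auto simp: osc_root_def simp del: add_eq_0_iff_eq split: option.splits)
  then show ?thesis by (simp add: num_osculating_pt)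
qed

abbreviation sl2_stab :: "('a ^ 4) set \<Rightarrow> ('a \<times> 'a \<times> 'a \<times> 'a) set" where
  "sl2_stab \<equiv> stabilizer sl2 (\<lambda>g. projectivity (twmat h g))"

lemma sl2_stab_pt:
  assumes "v \<noteq> 0"
  shows "g \<in> sl2_stab (pt v) \<longleftrightarrow> g \<in> carrier sl2 \<and> (\<exists>k. k \<noteq> 0 \<and> twmat h g *v v = k *s v)"
proof -
  have "twmat h g *v v \<noteq> 0" if "g \<in> carrier sl2"
    using that assms by (intro invertible_mult_nonzero invertible_twmat)
  then show ?thesis
    using assms by (auto simp: stabilizer_def projectivity_pt pt_eq_iff pt_scale)
qed

lemma orbit_stabilizer_pt:
  "v \<noteq> 0 \<Longrightarrow> card (sl2_orbit (pt v)) * card (sl2_stab (pt v))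
    = order (sl2 :: ('a \<times> 'a \<times> 'a \<times> 'a) monoid)"
  by (rule sl2.orbit_stabilizer_theorem[OF pt_in_PG3])

text \<open>The invariant quadratic form is multiplied by k^2 when v is scaled by k. Being nonzero
  at v it forces k^2 = 1, so k = 1 in characteristic 2.\<close>

lemma sl2_stab_nonquadric:
  fixes v :: "'a ^ 4"
  assumes Q: "v $ 1 * v $ 4 + v $ 2 * v $ 3 \<noteq> 0" and g: "g \<in> sl2_stab (pt v)"
  shows "twmat h g *v v = v"
proof -
  have "v \<noteq> 0" using Q by auto
  then obtain k where k: "g \<in> carrier sl2" "twmat h g *v v = k *s v"
    using g sl2_stab_pt by blast
  define w where "w = twmat h g *v v"
  have "w $ 1 * w $ 4 + w $ 2 * w $ 3 = v $ 1 * v $ 4 + v $ 2 * v $ 3"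
    using quadric_twmat[OF k(1) w_def] .
  moreover have "w $ 1 * w $ 4 + w $ 2 * w $ 3 = (k * k) * (v $ 1 * v $ 4 + v $ 2 * v $ 3)"
    by (simp add: w_def k(2) algebra_simps)
  ultimately have "k * k = 1" using Q by (metis mult_cancel_right1)
  then have "(k + 1) * (k + 1) = 0" by (simp add: algebra_simps)
  then have "k = 1" by simp
  then show ?thesis using k(2) by simp
qed

text \<open>Orbit-stabilizer for U_4: its orbit is the arc, and its stabilizer consists of the q (q
  - 1) lower triangular matrices.\<close>

lemma order_sl2: "order (sl2 :: ('a \<times> 'a \<times> 'a \<times> 'a) monoid)
    = (CARD('a) + 1) * (CARD('a) * (CARD('a) - 1))"
proof -
  have nz: "axis 4 1 \<noteq> (0 :: 'a ^ 4)" by (simp add: axis_eq_0_iff)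
  have "sl2_stab (pt (axis 4 1)) = (\<lambda>(a, c). (a, 0, c, inverse a)) ` ((UNIV - {0}) \<times> UNIV)"
  proof (rule Set.set_eqI)
    fix g :: "'a \<times> 'a \<times> 'a \<times> 'a"
    obtain a b c d where g: "g = (a, b, c, d)" by (cases g)
    have "g \<in> sl2_stab (pt (axis 4 1)) \<longleftrightarrow> a * d + b * c = 1 \<and> b = 0"
      unfolding sl2_stab_pt[OF nz] g carrier_sl2_iff
      by (auto simp: twmat_mult_vec vec4_eq_iff vector_4 axis_def intro!: exI[of _ "frob h d * d"])
    also have "\<dots> \<longleftrightarrow> a \<noteq> 0 \<and> d = inverse a \<and> b = 0"
      by (auto dest: inverse_unique)
    finally show "g \<in> sl2_stab (pt (axis 4 1))
        \<longleftrightarrow> g \<in> (\<lambda>(a, c). (a, 0, c, inverse a)) ` ((UNIV - {0}) \<times> UNIV)"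
      by (auto simp: g)
  qed
  moreover have "inj_on (\<lambda>(a, c). (a, 0 :: 'a, c, inverse a)) ((UNIV - {0 :: 'a}) \<times> (UNIV :: 'a set))"
    by (auto simp: inj_on_def)
  ultimately have "card (sl2_stab (pt (axis 4 1))) = CARD('a) * (CARD('a) - 1)"
    by (simp add: card_image card_cartesian_product)
  then show ?thesis
    using orbit_stabilizer_pt[OF nz] card_qarc card_field by (simp add: qarc_eq_orbit)
qed

lemma card_stab_rep_0_0: "card (sl2_stab (pt (orbit_rep 0 0))) = CARD('a) - 1"
proof -
  have "sl2_stab (pt (orbit_rep 0 0)) = (\<lambda>a. (a, 0, 0, inverse a)) ` (UNIV - {0})"
  proof (rule Set.set_eqI)
    fix g :: "'a \<times> 'a \<times> 'a \<times> 'a"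
    obtain a b c d where g: "g = (a, b, c, d)" by (cases g)
    have "g \<in> sl2_stab (pt (orbit_rep 0 0)) \<longleftrightarrow>
        a * d + b * c = 1 \<and> frob h a * b = 0 \<and> frob h c * b = 0 \<and> frob h c * d = 0 \<and> frob h a * d \<noteq> 0"
      unfolding sl2_stab_pt[OF orbit_rep_nonzero] g carrier_sl2_iff
      by (auto simp: twmat_mult_vec vec4_eq_iff vector_4)
    also have "\<dots> \<longleftrightarrow> a \<noteq> 0 \<and> d = inverse a \<and> b = 0 \<and> c = 0"
      by (auto simp: field_simps)
    finally show "g \<in> sl2_stab (pt (orbit_rep 0 0)) \<longleftrightarrow> g \<in> (\<lambda>a. (a, 0, 0, inverse a)) ` (UNIV - {0})"
      by (auto simp: g)
  qed
  moreover have "inj_on (\<lambda>a. (a, 0 :: 'a, 0 :: 'a, inverse a)) (UNIV - {0 :: 'a})" by (auto simp: inj_on_def)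
  ultimately show ?thesis by (simp add: card_image)
qed

text \<open>Here V is the alternating matrix J, for which g J g^T = J. So \<sigma>(g) J g^T = J
  forces \<sigma>(g) = g, and the stabilizer is SL(2,2), of order 6.\<close>

lemma card_stab_rep_1_0: "card (sl2_stab (pt (orbit_rep 1 0))) = 6"
proof -
  have "sl2_stab (pt (orbit_rep 1 0)) =
      {(1, 0, 0, 1), (0, 1, 1, 0), (1, 1, 0, 1), (1, 0, 1, 1), (1, 1, 1, 0), (0, 1, 1, 1)}"
  proof
    show "sl2_stab (pt (orbit_rep 1 0)) \<subseteq>
      {(1, 0, 0, 1), (0, 1, 1, 0), (1, 1, 0, 1), (1, 0, 1, 1), (1, 1, 1, 0), (0, 1, 1, 1)}"
    proof
      fix g :: "'a \<times> 'a \<times> 'a \<times> 'a"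
      assume st: "g \<in> sl2_stab (pt (orbit_rep 1 0))"
      obtain a b c d where g: "g = (a, b, c, d)" by (cases g)
      have D: "a * d + b * c = 1"
        using st unfolding sl2_stab_pt[OF orbit_rep_nonzero] g carrier_sl2_iff by blast
      have "twmat h g *v orbit_rep 1 0 = orbit_rep 1 0" by (rule sl2_stab_nonquadric[OF _ st]) simp
      then have eqs: "frob h a * b + frob h b * a = 0" "frob h a * d + frob h b * c = 1"
          "frob h c * b + frob h d * a = 1" "frob h c * d + frob h d * c = 0"
        by (simp_all add: g twmat_mult_vec vec4_eq_iff vector_4)
      have "frob h a = frob h a * (a * d + b * c) + (frob h a * b + frob h b * a) * c"
        using D eqs by simp
      also have "\<dots> = a * (frob h a * d + frob h b * c)" by (simp add: algebra_simps)
      finally have "frob h a = a" using eqs by simp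
      have "frob h b = frob h b * (a * d + b * c) + (frob h a * b + frob h b * a) * d"
        using D eqs by simp
      also have "\<dots> = b * (frob h a * d + frob h b * c)" by (simp add: algebra_simps)
      finally have "frob h b = b" using eqs by simp
      have "frob h c = frob h c * (a * d + b * c) + (frob h c * d + frob h d * c) * a"
        using D eqs by simp
      also have "\<dots> = c * (frob h c * b + frob h d * a)" by (simp add: algebra_simps)
      finally have "frob h c = c" using eqs by simp
      have "frob h d = frob h d * (a * d + b * c) + (frob h c * d + frob h d * c) * b"
        using D eqs by simp
      also have "\<dots> = d * (frob h c * b + frob h d * a)" by (simp add: algebra_simps)
      finally have "frob h d = d" using eqs by simp
      have "(a = 0 \<or> a = 1) \<and> (b = 0 \<or> b = 1) \<and> (c = 0 \<or> c = 1) \<and> (d = 0 \<or> d = 1)"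
        using \<open>frob h a = a\<close> \<open>frob h b = b\<close> \<open>frob h c = c\<close> \<open>frob h d = d\<close> frob_fixed by blast
      then show "g \<in> {(1, 0, 0, 1), (0, 1, 1, 0), (1, 1, 0, 1), (1, 0, 1, 1), (1, 1, 1, 0), (0, 1, 1, 1)}"
        using D by (elim conjE disjE) (simp_all add: g)
    qed
    show "{(1, 0, 0, 1), (0, 1, 1, 0), (1, 1, 0, 1), (1, 0, 1, 1), (1, 1, 1, 0), (0, 1, 1, 1)}
        \<subseteq> sl2_stab (pt (orbit_rep 1 0))"
      unfolding insert_subset sl2_stab_pt[OF orbit_rep_nonzero] carrier_sl2_iff
      by (simp add: twmat_mult_vec vec4_eq_iff vector_4)
  qed
  then show ?thesis by simp
qed

text \<open>If b were nonzero, a/b would solve \<sigma>(t) + t = e. So g is triangular, and the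
  remaining equations give a = d = 1 and \<sigma>(c) = c.\<close>

lemma card_stab_rep_1:
  assumes e: "e \<notin> artin_schreier_image"
  shows "card (sl2_stab (pt (orbit_rep 1 e))) = 2"
proof -
  have "sl2_stab (pt (orbit_rep 1 e)) = {(1, 0, 0, 1), (1, 0, 1, 1)}"
  proof
    show "sl2_stab (pt (orbit_rep 1 e)) \<subseteq> {(1, 0, 0, 1), (1, 0, 1, 1)}"
    proof
      fix g :: "'a \<times> 'a \<times> 'a \<times> 'a"
      assume st: "g \<in> sl2_stab (pt (orbit_rep 1 e))"
      obtain a b c d where g: "g = (a, b, c, d)" by (cases g)
      have D: "a * d + b * c = 1"
        using st unfolding sl2_stab_pt[OF orbit_rep_nonzero] g carrier_sl2_iff by blast
      have "twmat h g *v orbit_rep 1 e = orbit_rep 1 e" by (rule sl2_stab_nonquadric[OF _ st]) simp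
      then have eqs: "frob h a * b + frob h b * (a + b * e) = 0"
          "frob h a * d + frob h b * (c + d * e) = 1"
          "frob h c * b + frob h d * (a + b * e) = 1"
          "frob h c * d + frob h d * (c + d * e) = e"
        by (simp_all add: g twmat_mult_vec vec4_eq_iff vector_4 del: add_eq_0_iff_eq)
      have "b = 0"
      proof (rule ccontr)
        assume "b \<noteq> 0"
        have "frob h (a / b) + a / b + e = (frob h a * b + frob h b * (a + b * e)) / (frob h b * b)"
          using \<open>b \<noteq> 0\<close> by (simp add: frob_divide field_simps del: add_eq_0_iff_eq)
        then have "e = frob h (a / b) + a / b" unfolding eqs(1) by simp
        then show False using e by (auto simp: artin_schreier_image_def)
      qed
      then have ad: "a * d = 1" "frob h a * d = 1" using D eqs by simp_all
      then have "frob h a = a" by (metis mult_cancel_right mult_zero_right zero_neq_one)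
      then have "a = 1" "d = 1" using frob_fixed[of a] ad by auto
      then have "frob h c + c + e = e" using eqs(4) by (simp add: ac_simps)
      then have "frob h c = c" by simp
      then have "c = 0 \<or> c = 1" by (rule frob_fixed)
      then show "g \<in> {(1, 0, 0, 1), (1, 0, 1, 1)}"
        using \<open>a = 1\<close> \<open>b = 0\<close> \<open>d = 1\<close> by (auto simp: g)
    qed
    show "{(1, 0, 0, 1), (1, 0, 1, 1)} \<subseteq> sl2_stab (pt (orbit_rep 1 e))"
      unfolding insert_subset sl2_stab_pt[OF orbit_rep_nonzero] carrier_sl2_iff
      by (simp add: twmat_mult_vec vec4_eq_iff vector_4)
  qed
  then show ?thesis by simp
qed

text \<open>The condition is \<open>\<sigma>(g) V = V g'\<close> with \<open>g'\<close> the transposed adjugate of \<open>g\<close> (signs are irrelevant in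
  characteristic 2). Unlike the stabilizer, this set is closed under addition.\<close>

definition twisted_commutant :: "'a ^ 4 \<Rightarrow> ('a \<times> 'a \<times> 'a \<times> 'a) set" where
  "twisted_commutant v = {(a, b, c, d).
     frob h a * v $ 1 + frob h b * v $ 3 = v $ 1 * d + v $ 2 * b
     \<and> frob h a * v $ 2 + frob h b * v $ 4 = v $ 1 * c + v $ 2 * a
     \<and> frob h c * v $ 1 + frob h d * v $ 3 = v $ 3 * d + v $ 4 * b
     \<and> frob h c * v $ 2 + frob h d * v $ 4 = v $ 3 * c + v $ 4 * a}"

lemma twisted_commutant_add:
  assumes "(a, b, c, d) \<in> twisted_commutant v" "(a', b', c', d') \<in> twisted_commutant v"
  shows "(a + a', b + b', c + c', d + d') \<in> twisted_commutant v"
proof -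
  have "\<lbrakk>A * x + B * y = p; A' * x + B' * y = p'\<rbrakk> \<Longrightarrow> (A + A') * x + (B + B') * y = p + p'"
    for A B A' B' x y p p' :: 'a
    by (auto simp: algebra_simps)
  moreover have "x * (d + d') + y * (b + b') = (x * d + y * b) + (x * d' + y * b')"
    for x y b d b' d' :: 'a
    by (simp add: algebra_simps)
  ultimately show ?thesis
    using assms unfolding twisted_commutant_def mem_Collect_eq case_prod_conv frob_add by presburger
qed

text \<open>Multiply \<sigma>(g) V g^T = V on the right by the inverse of g^T, which is its
  adjugate; \<open>key\<close> does this for one row.\<close>

lemma stab_in_twisted_commutant:
  assumes D: "a * d + b * c = 1" and fixed: "twmat h (a, b, c, d) *v v = v"
  shows "(a, b, c, d) \<in> twisted_commutant v"
proof -
  have eqs: "v $ 1 = frob h a * (a * v $ 1 + b * v $ 2) + frob h b * (a * v $ 3 + b * v $ 4)"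
     "v $ 2 = frob h a * (c * v $ 1 + d * v $ 2) + frob h b * (c * v $ 3 + d * v $ 4)"
     "v $ 3 = frob h c * (a * v $ 1 + b * v $ 2) + frob h d * (a * v $ 3 + b * v $ 4)"
     "v $ 4 = frob h c * (c * v $ 1 + d * v $ 2) + frob h d * (c * v $ 3 + d * v $ 4)"
    using arg_cong[OF fixed, of "\<lambda>w. w $ 1"] arg_cong[OF fixed, of "\<lambda>w. w $ 2"]
      arg_cong[OF fixed, of "\<lambda>w. w $ 3"] arg_cong[OF fixed, of "\<lambda>w. w $ 4"]
    unfolding twmat_mult_vec vector_4 by metis+
  have key: "A * x + B * z = X * d + Y * b" "A * y + B * w = X * c + Y * a"
    if "X = A * (a * x + b * y) + B * (a * z + b * w)" "Y = A * (c * x + d * y) + B * (c * z + d * w)"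
    for A B x y z w X Y
  proof -
    have "X * d + Y * b = (a * d + b * c) * (A * x + B * z)"
      "X * c + Y * a = (a * d + b * c) * (A * y + B * w)"
      unfolding that by (simp_all add: algebra_simps)
    then show "A * x + B * z = X * d + Y * b" "A * y + B * w = X * c + Y * a"
      by (simp_all only: D mult_1)
  qed
  show ?thesis
    unfolding twisted_commutant_def mem_Collect_eq case_prod_conv
    using key[OF eqs(1,2)] key[OF eqs(3,4)] by simp
qed

text \<open>V is invertible, so \<sigma>(g) is conjugate to the transposed adjugate of g. That
  matrix has the trace and determinant of g, hence both are fixed by \<sigma>.\<close>

lemma twisted_commutant_trace_det:
  assumes Q: "v $ 1 * v $ 4 + v $ 2 * v $ 3 \<noteq> 0" and E: "(a, b, c, d) \<in> twisted_commutant v"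
  shows "a + d = 0 \<or> a + d = 1" and "a * d + b * c = 0 \<or> a * d + b * c = 1"
proof -
  let ?Q = "v $ 1 * v $ 4 + v $ 2 * v $ 3"
  have eqs: "frob h a * v $ 1 + frob h b * v $ 3 = v $ 1 * d + v $ 2 * b"
    "frob h a * v $ 2 + frob h b * v $ 4 = v $ 1 * c + v $ 2 * a"
    "frob h c * v $ 1 + frob h d * v $ 3 = v $ 3 * d + v $ 4 * b"
    "frob h c * v $ 2 + frob h d * v $ 4 = v $ 3 * c + v $ 4 * a"
    using E by (simp_all add: twisted_commutant_def)
  have "frob h (a + d) * ?Q =
      v $ 4 * (frob h a * v $ 1 + frob h b * v $ 3) + v $ 3 * (frob h a * v $ 2 + frob h b * v $ 4)
      + v $ 2 * (frob h c * v $ 1 + frob h d * v $ 3) + v $ 1 * (frob h c * v $ 2 + frob h d * v $ 4)"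
    by (simp add: frob_add algebra_simps)
  also have "\<dots> = (a + d) * ?Q" unfolding eqs by (simp add: algebra_simps)
  finally have "frob h (a + d) = a + d" using Q by (metis mult_right_cancel)
  then show "a + d = 0 \<or> a + d = 1" by (rule frob_fixed)
  have "frob h (a * d + b * c) * ?Q =
      (frob h a * v $ 1 + frob h b * v $ 3) * (frob h c * v $ 2 + frob h d * v $ 4)
      + (frob h a * v $ 2 + frob h b * v $ 4) * (frob h c * v $ 1 + frob h d * v $ 3)"
    by (simp add: frob_add frob_mult algebra_simps)
  also have "\<dots> = (a * d + b * c) * ?Q" unfolding eqs by (simp add: algebra_simps)
  finally have "frob h (a * d + b * c) = a * d + b * c" using Q by (metis mult_right_cancel)
  then show "a * d + b * c = 0 \<or> a * d + b * c = 1" by (rule frob_fixed)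
qed

text \<open>Dividing by \<sigma>(y) y dehomogenizes the form, so a nontrivial zero gives the root
  x/y, or the root at infinity when y = 0.\<close>

lemma no_osc_root_form:
  assumes no: "\<And>s. \<not> osc_root h v s"
    and 0: "frob h x * (x * v $ 1 + y * v $ 2) + frob h y * (x * v $ 3 + y * v $ 4) = 0"
  shows "x = 0 \<and> y = (0 :: 'a)"
proof (cases "y = 0")
  case True
  then show ?thesis using 0 no[of None] by (auto simp: osc_root_def)
next
  case False
  have "frob h (x / y) * (x / y * v $ 1 + v $ 2) + x / y * v $ 3 + v $ 4 =
     (frob h x * (x * v $ 1 + y * v $ 2) + frob h y * (x * v $ 3 + y * v $ 4)) / (frob h y * y)"
    using False by (simp add: frob_divide field_simps del: add_eq_0_iff_eq)
  then have "osc_root h v (Some (x / y))"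
    unfolding 0 by (simp add: osc_root_def del: add_eq_0_iff_eq)
  then show ?thesis using no by blast
qed

text \<open>The osculating form takes the values \<open>v $ 1\<close> and \<open>v $ 4\<close> times
  the determinant on the two rows. With determinant 0 both rows are zeros of a form without
  nontrivial zeros.\<close>

lemma twisted_commutant_singular:
  assumes no: "\<And>s. \<not> osc_root h v s" and E: "(a, b, c, d) \<in> twisted_commutant v"
    and D: "a * d + b * c = 0"
  shows "a = 0 \<and> b = 0 \<and> c = 0 \<and> d = 0"
proof -
  have eqs: "frob h a * v $ 1 + frob h b * v $ 3 = v $ 1 * d + v $ 2 * b"
    "frob h a * v $ 2 + frob h b * v $ 4 = v $ 1 * c + v $ 2 * a"
    "frob h c * v $ 1 + frob h d * v $ 3 = v $ 3 * d + v $ 4 * b"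
    "frob h c * v $ 2 + frob h d * v $ 4 = v $ 3 * c + v $ 4 * a"
    using E by (simp_all add: twisted_commutant_def)
  have "frob h a * (a * v $ 1 + b * v $ 2) + frob h b * (a * v $ 3 + b * v $ 4)
      = a * (frob h a * v $ 1 + frob h b * v $ 3) + b * (frob h a * v $ 2 + frob h b * v $ 4)"
    by (simp add: algebra_simps)
  also have "\<dots> = v $ 1 * (a * d + b * c)" unfolding eqs by (simp add: algebra_simps)
  finally have ab: "a = 0 \<and> b = 0" using no_osc_root_form[OF no] D by simp
  have "frob h c * (c * v $ 1 + d * v $ 2) + frob h d * (c * v $ 3 + d * v $ 4)
      = c * (frob h c * v $ 1 + frob h d * v $ 3) + d * (frob h c * v $ 2 + frob h d * v $ 4)"
    by (simp add: algebra_simps)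
  also have "\<dots> = v $ 4 * (a * d + b * c)" unfolding eqs by (simp add: algebra_simps)
  finally have "c = 0 \<and> d = 0" using no_osc_root_form[OF no] D by simp
  then show ?thesis using ab by simp
qed

text \<open>V is singular, so its rows are dependent: the t that annihilates the first row
  annihilates the second as well.\<close>

lemma quadric_osc_root:
  assumes "v $ 1 * v $ 4 + v $ 2 * v $ 3 = (0 :: 'a)"
  shows "\<exists>s. osc_root h v s"
proof (cases "v $ 1 = 0")
  case True
  then show ?thesis by (intro exI[of _ None]) (simp add: osc_root_def)
next
  case False
  then have 4: "v $ 4 = v $ 2 * v $ 3 / v $ 1" using assms by (simp add: field_simps)
  have "osc_root h v (Some (v $ 2 / v $ 1))"
    using False by (simp add: osc_root_def 4)
  then show ?thesis ..
qed

text \<open>Without osculating planes through the point, the twisted commutant is a division algebra over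
  the prime field, in which every element except 0 and 1 has trace 1; hence it has at most 4 elements.\<close>

lemma card_stab_no_osc:
  assumes no: "\<And>s. \<not> osc_root h v s"
  shows "card (sl2_stab (pt (v :: 'a ^ 4))) \<le> 3"
proof -
  have Q: "v $ 1 * v $ 4 + v $ 2 * v $ 3 \<noteq> 0" using no quadric_osc_root by blast
  then have "v \<noteq> 0" by auto
  define T where "T = {(a, b, c, d). (a, b, c, d) \<in> twisted_commutant v \<and> a * d + b * c = 1}"
  have sub: "sl2_stab (pt v) \<subseteq> T"
  proof
    fix g assume st: "g \<in> sl2_stab (pt v)"
    obtain a b c d where g: "g = (a, b, c, d)" by (cases g)
    have "a * d + b * c = 1" using st sl2_stab_pt[OF \<open>v \<noteq> 0\<close>] by (simp add: g carrier_sl2_iff)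
    then show "g \<in> T"
      using stab_in_twisted_commutant sl2_stab_nonquadric[OF Q st] by (simp add: T_def g)
  qed
  have one: "(1, 0, 0, 1) \<in> twisted_commutant v" by (simp add: twisted_commutant_def)
  \<comment> \<open>For trace 0 and determinant 1, adding the identity gives determinant 0, hence
    the zero matrix.\<close>
  have tr0: "a = 1 \<and> b = 0 \<and> c = 0 \<and> d = 1" if "(a, b, c, d) \<in> T" "a + d = 0" for a b c d
  proof -
    have E: "(a + 1, b + 0, c + 0, d + 1) \<in> twisted_commutant v"
      using that one by (intro twisted_commutant_add) (simp_all add: T_def)
    have "(a + 1) * (d + 1) + (b + 0) * (c + 0) = (a * d + b * c) + (a + d) + 1"
      by (simp add: algebra_simps)
    moreover have "a * d + b * c = 1" using that(1) by (simp add: T_def)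
    ultimately have "(a + 1) * (d + 1) + (b + 0) * (c + 0) = 0"
      by (simp only: that(2) add_0_right add_self)
    then have "a + 1 = 0 \<and> b + 0 = 0 \<and> c + 0 = 0 \<and> d + 1 = 0"
      by (rule twisted_commutant_singular[OF no E])
    then show ?thesis by simp
  qed
  \<comment> \<open>The sum of two elements of trace 1 has trace 0 and determinant 0 or 1, so it is
    zero or the identity.\<close>
  have tr1: "(a', b', c', d') = (a, b, c, d) \<or> (a', b', c', d') = (a + 1, b, c, d + 1)"
    if T: "(a, b, c, d) \<in> T" "(a', b', c', d') \<in> T" and tr: "a + d = 1" "a' + d' = 1"
    for a b c d a' b' c' d'
  proof -
    have E: "(a + a', b + b', c + c', d + d') \<in> twisted_commutant v"
      using T by (intro twisted_commutant_add) (simp_all add: T_def)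
    have tr': "(a + a') + (d + d') = 0"
    proof -
      have "(a + a') + (d + d') = (a + d) + (a' + d')" by (simp add: ac_simps)
      then show ?thesis by (simp only: tr add_self)
    qed
    consider "(a + a') * (d + d') + (b + b') * (c + c') = 0"
      | "(a + a') * (d + d') + (b + b') * (c + c') = 1"
      using twisted_commutant_trace_det(2)[OF Q E] by blast
    then show ?thesis
    proof cases
      case 1
      then show ?thesis using twisted_commutant_singular[OF no E] by auto
    next
      case 2
      then have "a + a' = 1 \<and> b + b' = 0 \<and> c + c' = 0 \<and> d + d' = 1"
        using E tr' by (intro tr0) (simp_all add: T_def)
      then have "a' = a + 1" "d' = d + 1" "b' = b" "c' = c" by (metis add_self_left add_eq_0_iff_eq)+
      then show ?thesis by simp
    qed
  qed
  have "\<exists>x y z. T \<subseteq> {x, y, z}"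
  proof (cases "\<exists>a b c d. (a, b, c, d) \<in> T \<and> a + d = 1")
    case True
    then obtain a b c d where abcd: "(a, b, c, d) \<in> T" "a + d = 1" by blast
    have "T \<subseteq> {(1, 0, 0, 1), (a, b, c, d), (a + 1, b, c, d + 1)}"
    proof
      fix g assume gT: "g \<in> T"
      obtain a' b' c' d' where g: "g = (a', b', c', d')" by (cases g)
      have "a' + d' = 0 \<or> a' + d' = 1"
        using gT twisted_commutant_trace_det(1)[OF Q] unfolding T_def g by blast
      then show "g \<in> {(1, 0, 0, 1), (a, b, c, d), (a + 1, b, c, d + 1)}"
        using tr0 tr1[OF abcd(1) _ abcd(2)] gT unfolding g by blast
    qed
    then show ?thesis by blast
  next
    case False
    have "T \<subseteq> {(1, 0, 0, 1)}"
    proof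
      fix g assume gT: "g \<in> T"
      obtain a' b' c' d' where g: "g = (a', b', c', d')" by (cases g)
      have "a' + d' = 0 \<or> a' + d' = 1"
        using gT twisted_commutant_trace_det(1)[OF Q] unfolding T_def g by blast
      then show "g \<in> {(1, 0, 0, 1)}" using tr0 False gT unfolding g by blast
    qed
    then show ?thesis by blast
  qed
  then obtain x y z where "sl2_stab (pt v) \<subseteq> {x, y, z}" using sub by blast
  then have "card (sl2_stab (pt v)) \<le> card {x, y, z}" by (intro card_mono) auto
  also have "\<dots> \<le> 3" by (simp add: card_insert_if)
  finally show ?thesis .
qed

subsection \<open>The orbits\<close>

text \<open>Removing the arc separates it from the other points on exactly one osculating
  plane.\<close>

definition num_class :: "nat \<Rightarrow> ('a ^ 4) set set" where
  "num_class k = {P \<in> PG3 - qarc h. num_osculating h P = k}"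

lemma num_osculating_eq_0_iff:
  "num_osculating h (P :: ('a ^ 4) set) = 0 \<longleftrightarrow> (\<forall>\<pi>\<in>osculating_planes h. \<not> P \<subseteq> \<pi>)"
  by (auto simp: num_osculating_def)

lemma exists_not_artin_schreier_image:
  obtains e where "e \<notin> artin_schreier_image"
  using artin_schreier_image_neq_UNIV by blast

lemma num_class_orbit:
  assumes v: "v \<noteq> 0" "pt v \<notin> qarc h"
    and cases: "\<And>P. P \<in> num_class (num_osculating h (pt v)) \<Longrightarrow> P \<in> sl2_orbit (pt v)"
  shows "num_class (num_osculating h (pt v)) = sl2_orbit (pt v)"
proof
  show "sl2_orbit (pt v) \<subseteq> num_class (num_osculating h (pt v))"
  proof
    fix P assume P: "P \<in> sl2_orbit (pt v)"
    then have PG: "P \<in> PG3" using sl2_orbit_subset[OF pt_in_PG3[OF v(1)]] by blast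
    have "P \<notin> qarc h"
    proof
      assume "P \<in> qarc h"
      moreover have "pt v \<in> sl2_orbit P" using sl2.orbit_sym[OF _ PG P] v by simp
      ultimately have "pt v \<in> qarc h"
        using twmat_qarc PG by (auto simp: orbit_def projectivity_def)
      then show False using v by simp
    qed
    then show "P \<in> num_class (num_osculating h (pt v))"
      using PG sl2_orbit_num[OF _ P] v by (simp add: num_class_def)
  qed
qed (use cases in blast)

lemma num_class_pos_cases:
  assumes P: "P \<in> num_class k" "k > 0" and e: "e \<notin> artin_schreier_image"
  shows "P \<in> sl2_orbit (pt (orbit_rep 0 0)) \<and> k = 2 \<or> P \<in> sl2_orbit (pt (orbit_rep 1 0)) \<and> k = 3
    \<or> P \<in> sl2_orbit (pt (orbit_rep 1 e)) \<and> k = 1"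
proof -
  obtain v where v: "v \<noteq> 0" "P = pt v" using P by (auto simp: num_class_def elim: PG3_cases)
  have "card {s. osc_root h v s} \<noteq> 0"
    using P by (auto simp: num_class_def v num_osculating_pt)
  then have "{s. osc_root h v s} \<noteq> {}" by (metis card.empty)
  then obtain s where "osc_root h v s" by blast
  then have "P \<in> sl2_orbit (pt (orbit_rep 0 0)) \<or> P \<in> sl2_orbit (pt (orbit_rep 1 0)) \<or> P \<in> sl2_orbit (pt (orbit_rep 1 e))"
    using sl2_orbit_cases[OF v(1) e] P by (auto simp: num_class_def v)
  moreover have "k = num_osculating h (pt (orbit_rep c d))" if "P \<in> sl2_orbit (pt (orbit_rep c d))" for c d
    using sl2_orbit_num[OF _ that] P by (simp add: num_class_def)
  ultimately show ?thesis
    using num_osculating_rep_0_0 num_osculating_rep_1_0 num_osculating_rep_1[OF e] by metis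
qed

text \<open>The number of osculating planes tells the first two from arc points. The third agrees
  with them in that number, but lies off the quadric that contains the arc.\<close>

lemma rep_notin_qarc:
  assumes "e \<notin> artin_schreier_image"
  shows "pt (orbit_rep 0 0) \<notin> qarc h" "pt (orbit_rep 1 0) \<notin> qarc h" "pt (orbit_rep 1 e) \<notin> qarc h"
proof -
  show "pt (orbit_rep 0 0) \<notin> qarc h" "pt (orbit_rep 1 0) \<notin> qarc h"
    using num_osculating_qarc num_osculating_rep_0_0 num_osculating_rep_1_0 by force+
  have "x $ 1 * x $ 4 + x $ 2 * x $ 3 = 0" if P: "P \<in> qarc h" "x \<in> P" for P and x :: "'a ^ 4"
  proof -
    obtain y z where "P = pt (twvec h y z)" using P(1) by (rule qarc_cases)
    then show ?thesis
      using P(2) by (auto simp: mem_pt_iff twvec_def vector_4 ac_simps)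
  qed
  moreover have "orbit_rep 1 e \<in> pt (orbit_rep 1 e)" by (metis mem_pt_iff vector_smult_lid)
  ultimately show "pt (orbit_rep 1 e) \<notin> qarc h" by force
qed

lemma num_class_eq_orbit:
  assumes e: "e \<notin> artin_schreier_image"
  shows "num_class 1 = sl2_orbit (pt (orbit_rep 1 e))" "num_class 2 = sl2_orbit (pt (orbit_rep 0 0))"
    "num_class 3 = sl2_orbit (pt (orbit_rep 1 0))"
  using num_class_orbit[OF orbit_rep_nonzero rep_notin_qarc(3)[OF e]]
    num_class_orbit[OF orbit_rep_nonzero rep_notin_qarc(1)[OF e]]
    num_class_orbit[OF orbit_rep_nonzero rep_notin_qarc(2)[OF e]]
    num_class_pos_cases[OF _ _ e]
  unfolding num_osculating_rep_0_0 num_osculating_rep_1_0 num_osculating_rep_1[OF e] by fastforce+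

lemma PG3_partition:
  "PG3 = qarc h \<union> num_class 0 \<union> num_class 1 \<union> num_class 2 \<union> num_class 3"
proof -
  obtain e where e: "e \<notin> artin_schreier_image" using exists_not_artin_schreier_image .
  have "P \<in> qarc h \<union> num_class 0 \<union> num_class 1 \<union> num_class 2 \<union> num_class 3" if "P \<in> PG3" for P
  proof (cases "P \<in> qarc h")
    case False
    then have "P \<in> num_class (num_osculating h P)" using that by (simp add: num_class_def)
    then show ?thesis using num_class_pos_cases[OF _ _ e, of P "num_osculating h P"]
      by (cases "num_osculating h P = 0") auto
  qed simp
  then show ?thesis using qarc_subset[of h] by (auto simp: num_class_def)
qed

text \<open>Three sizes come from orbit-stabilizer with stabilizers of order 2, q - 1 and 6; the
  class 0 is what remains of all points.\<close>

lemma card_num_class: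
  fixes q :: nat
  assumes q: "q = CARD('a)"
  shows "card (num_class 1) * 2 = (q + 1) * (q * (q - 1))"
    and "card (num_class 2) = q * (q + 1)"
    and "card (num_class 3) * 6 = (q + 1) * (q * (q - 1))"
    and "card (num_class 0) * 3 = (q + 1) * (q * (q - 1))"
proof -
  obtain e where e: "e \<notin> artin_schreier_image" using exists_not_artin_schreier_image .
  have "(2::nat) ^ 3 \<le> 2 ^ n" using n3 by (intro power_increasing) auto
  then have q8: "q \<ge> 8" using q card_field by simp
  define m where "m = (q + 1) * (q * (q - 1))"
  have order: "order (sl2 :: ('a \<times> 'a \<times> 'a \<times> 'a) monoid) = m" by (simp add: order_sl2 q m_def)
  show 1: "card (num_class 1) * 2 = (q + 1) * (q * (q - 1))"
    using orbit_stabilizer_pt[OF orbit_rep_nonzero, of 1 e] card_stab_rep_1[OF e]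
    unfolding num_class_eq_orbit[OF e] by (simp add: order m_def)
  show 3: "card (num_class 3) * 6 = (q + 1) * (q * (q - 1))"
    using orbit_stabilizer_pt[OF orbit_rep_nonzero, of 1 0] card_stab_rep_1_0
    by (simp add: num_class_eq_orbit[OF e] order m_def)
  have "card (num_class 2) * (q - 1) = m"
    using orbit_stabilizer_pt[OF orbit_rep_nonzero, of 0 0] card_stab_rep_0_0
    by (simp add: num_class_eq_orbit[OF e] order q)
  also have "m = q * (q + 1) * (q - 1)" by (simp only: m_def ac_simps)
  finally have "card (num_class 2) * (q - 1) = q * (q + 1) * (q - 1)" .
  then show 2: "card (num_class 2) = q * (q + 1)" using q8 by simp
  have "card (PG3 :: ('a ^ 4) set set)
      = card (qarc h \<union> num_class 0 \<union> num_class 1 \<union> num_class 2 \<union> num_class 3)"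
    by (simp only: PG3_partition[symmetric])
  also have "\<dots> = card (qarc h :: ('a ^ 4) set set)
      + card (num_class 0) + card (num_class 1) + card (num_class 2) + card (num_class 3)"
    by (subst card_Un_disjoint, simp, simp, force simp: num_class_def)+ simp
  finally have tot: "card (PG3 :: ('a ^ 4) set set)
      = q + 1 + card (num_class 0) + card (num_class 1) + card (num_class 2) + card (num_class 3)"
    using card_qarc card_field q by simp
  have PG: "card (PG3 :: ('a ^ 4) set set) * (q - 1) = q ^ 4 - 1" using card_PG3 q by simp
  obtain r where r: "q = Suc r" using q8 by (cases q) auto
  then have r0: "r \<noteq> 0" using q8 by auto
  \<comment> \<open>The factorization of q^4 - 1 by q - 1, with q = r + 1 to avoid truncated
    subtraction.\<close>
  have "r * (Suc r ^ 3 + Suc r ^ 2 + Suc r + 1) + 1 = Suc r ^ 4"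
    by (simp add: eval_nat_numeral algebra_simps)
  then have "card (PG3 :: ('a ^ 4) set set) * r = r * (Suc r ^ 3 + Suc r ^ 2 + Suc r + 1)"
    using PG by (simp add: r)
  then have "card (PG3 :: ('a ^ 4) set set) = Suc r ^ 3 + Suc r ^ 2 + Suc r + 1"
    using r0 by (metis mult.commute mult_left_cancel)
  moreover have "Suc r ^ 3 = (q + 1) * (q * (q - 1)) + q" "Suc r ^ 2 + Suc r = q * (q + 1)"
    by (simp_all add: r eval_nat_numeral algebra_simps)
  ultimately show "card (num_class 0) * 3 = (q + 1) * (q * (q - 1))"
    using tot 1 2 3 r by linarith
qed

lemma num_class_nonempty:
  assumes "k \<le> 3"
  shows "num_class k \<noteq> {}"
proof -
  have "CARD('a) > 1" using card_field_gt_2 by simp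
  then have "card (num_class 0) \<noteq> 0" "card (num_class 1) \<noteq> 0" "card (num_class 2) \<noteq> 0"
      "card (num_class 3) \<noteq> 0"
    using card_num_class[OF refl] by auto
  moreover have "k = 0 \<or> k = 1 \<or> k = 2 \<or> k = 3" using assms by linarith
  ultimately show ?thesis by (metis card.empty)
qed

text \<open>A stabilizer of order at most 3 makes each orbit in the class at least a third of the
  group order, which is the size of the whole class.\<close>

lemma num_class_0_orbit:
  assumes P: "P \<in> num_class 0"
  shows "num_class 0 = sl2_orbit P"
proof -
  obtain v where v: "v \<noteq> 0" "P = pt v" using P by (auto simp: num_class_def elim: PG3_cases)
  have no: "\<not> osc_root h v s" for s
    using P by (auto simp: num_class_def v num_osculating_pt)
  have "sl2_orbit P \<subseteq> num_class 0"
  proof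
    fix Q assume Q: "Q \<in> sl2_orbit P"
    then have "num_osculating h Q = 0" "Q \<in> PG3"
      using sl2_orbit_num sl2_orbit_subset P by (force simp: num_class_def)+
    then show "Q \<in> num_class 0" using num_osculating_qarc by (force simp: num_class_def)
  qed
  moreover have "card (num_class 0) \<le> card (sl2_orbit P)"
  proof -
    have "card (num_class 0) * 3 = card (sl2_orbit P) * card (sl2_stab P)"
      using card_num_class(4)[OF refl] orbit_stabilizer_pt[OF v(1)] by (simp add: order_sl2 v(2))
    also have "\<dots> \<le> card (sl2_orbit P) * 3"
      using card_stab_no_osc[OF no] by (intro mult_left_mono) (simp_all add: v(2))
    finally show ?thesis by simp
  qed
  ultimately show ?thesis by (metis card_seteq finite)
qed

text \<open>The quadric is invariant, so testing representatives decides the classes 1, 2 and 3;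
  class 0 is excluded because a point of the quadric has an osculating root.\<close>

lemma hyperbolic_quadric_diff_qarc: "hyperbolic_quadric - qarc h = num_class 2"
proof -
  obtain e where e: "e \<notin> artin_schreier_image" using exists_not_artin_schreier_image .
  let ?Q = "\<lambda>v :: 'a ^ 4. v $ 1 * v $ 4 + v $ 2 * v $ 3"
  have HQ: "pt v \<in> hyperbolic_quadric \<longleftrightarrow> ?Q v = 0" if "v \<noteq> 0" for v
  proof -
    have "?Q (k *s v) = k * k * ?Q v" for k by (simp add: algebra_simps)
    then show ?thesis
      unfolding hyperbolic_quadric_def mem_Collect_eq Ball_def mem_pt_iff
      using that by (metis mult_zero_right pt_in_PG3 vector_smult_lid)
  qed
  have inv: "P \<in> hyperbolic_quadric \<longleftrightarrow> ?Q u = 0" if P: "P \<in> sl2_orbit (pt u)" and u: "u \<noteq> 0" for P u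
  proof -
    obtain g where g: "g \<in> carrier sl2" "P = pt (twmat h g *v u)"
      using P u by (auto simp: orbit_def projectivity_pt)
    have "twmat h g *v u \<noteq> 0" using g u by (intro invertible_mult_nonzero invertible_twmat)
    then show ?thesis unfolding g(2) using HQ quadric_twmat[OF g(1) refl, of u] by metis
  qed
  show ?thesis
  proof
    show "num_class 2 \<subseteq> hyperbolic_quadric - qarc h"
      using inv[of _ "orbit_rep 0 0"] num_class_eq_orbit(2)[OF e] by (auto simp: num_class_def)
    show "hyperbolic_quadric - qarc h \<subseteq> num_class 2"
    proof
      fix P :: "('a ^ 4) set" assume P: "P \<in> hyperbolic_quadric - qarc h"
      then have PG: "P \<in> PG3" by (auto simp: hyperbolic_quadric_def)
      then obtain v where v: "v \<noteq> 0" "P = pt v" by (rule PG3_cases)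
      have "?Q v = 0" using P HQ[OF v(1)] by (simp add: v(2))
      then obtain s where s: "osc_root h v s" using quadric_osc_root by metis
      have "P \<notin> num_class 0" using s by (auto simp: num_class_def v num_osculating_pt)
      moreover have "P \<notin> num_class 1" "P \<notin> num_class 3"
        using inv[of P "orbit_rep 1 e"] inv[of P "orbit_rep 1 0"] P num_class_eq_orbit[OF e] by auto
      ultimately show "P \<in> num_class 2" using PG P PG3_partition by blast
    qed
  qed
qed

section \<open>Orbits of the full stabilizer of the arc\<close>

lemma arc_group_orbit:
  assumes X: "X \<subseteq> PG3" "P \<in> X" "X \<subseteq> sl2_orbit P"
    and inv: "\<And>g Q. g \<in> carrier (arc_group h) \<Longrightarrow> Q \<in> X \<Longrightarrow> g Q \<in> X"
  shows "orbit (arc_group h) (\<lambda>g. g) P = X"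
proof
  show "orbit (arc_group h) (\<lambda>g. g) P \<subseteq> X" using inv X(2) by (auto simp: orbit_def)
  show "X \<subseteq> orbit (arc_group h) (\<lambda>g. g) P"
    using X(3) projectivity_in_arc_group unfolding orbit_def by blast
qed

lemma arc_group_qarc_iff:
  assumes g: "g \<in> carrier (arc_group h)" and P: "(P :: ('a ^ 4) set) \<in> PG3"
  shows "g P \<in> qarc h \<longleftrightarrow> P \<in> qarc h"
proof -
  have im: "g ` qarc h = qarc h" using g by (simp add: arc_group_def)
  have "inj_on g PG3" using group_action.inj_prop[OF group_action_arc_group g] .
  then show ?thesis using im P qarc_subset[of h] by (metis inj_on_image_mem_iff)
qed

text \<open>The class is a single orbit of SL(2,q), and the larger group preserves it because it
  preserves the arc and the number of osculating planes.\<close>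

lemma arc_group_orbit_num_class:
  assumes P: "P \<in> num_class k" and k: "k \<le> 3"
  shows "orbit (arc_group h) (\<lambda>g. g) P = num_class k"
proof (rule arc_group_orbit)
  have PG: "P \<in> PG3" using P by (simp add: num_class_def)
  obtain e where e: "e \<notin> artin_schreier_image" using exists_not_artin_schreier_image .
  have "\<exists>R\<in>PG3. num_class k = sl2_orbit R"
  proof -
    consider "k = 0" | "k = 1" | "k = 2" | "k = 3" using k by linarith
    then show ?thesis
      by cases (use num_class_0_orbit P PG num_class_eq_orbit[OF e] in \<open>auto intro!: pt_in_PG3\<close>)
  qed
  then show "num_class k \<subseteq> sl2_orbit P" using sl2_orbit_eq P by auto
  show "g Q \<in> num_class k" if "g \<in> carrier (arc_group h)" "Q \<in> num_class k" for g Q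
    using that num_osculating_arc_group[OF that(1)] arc_group_qarc_iff[OF that(1)]
      group_action.element_image[OF group_action_arc_group that(1) _ refl]
    by (auto simp: num_class_def)
qed (use P in \<open>auto simp: num_class_def\<close>)

lemma arc_group_orbit_qarc:
  assumes P: "(P :: ('a ^ 4) set) \<in> qarc h"
  shows "orbit (arc_group h) (\<lambda>g. g) P = qarc h"
proof (rule arc_group_orbit)
  have "axis 4 1 \<noteq> (0 :: 'a ^ 4)" by (simp add: axis_eq_0_iff)
  then show "qarc h \<subseteq> sl2_orbit P"
    using P sl2_orbit_eq[of "pt (axis 4 1)" P] by (simp add: qarc_eq_orbit)
  show "g Q \<in> qarc h" if "g \<in> carrier (arc_group h)" "Q \<in> (qarc h :: ('a ^ 4) set set)" for g Q
    using that by (auto simp: arc_group_def)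
qed (use P qarc_subset in auto)

lemma orbits_arc_group:
  "orbits (arc_group h) PG3 (\<lambda>g. g) = {qarc h, num_class 0, num_class 1, num_class 2, num_class 3}"
  (is "_ = ?X")
proof -
  have nq: "\<exists>P. P \<in> (qarc h :: ('a ^ 4) set set)" by (auto simp: qarc_def)
  have 1: "orbit (arc_group h) (\<lambda>g. g) P \<in> ?X" if "P \<in> PG3" for P
  proof (cases "P \<in> qarc h")
    case True
    then show ?thesis using arc_group_orbit_qarc by simp
  next
    case False
    then obtain k where k: "P \<in> num_class k" "k \<in> {0, 1, 2, 3}" using \<open>P \<in> PG3\<close> PG3_partition by blast
    then have "orbit (arc_group h) (\<lambda>g. g) P = num_class k" by (intro arc_group_orbit_num_class) auto
    then show ?thesis using k(2) by blast
  qed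
  have 2: "\<exists>P\<in>PG3. X = orbit (arc_group h) (\<lambda>g. g) P" if "X \<in> ?X" for X
  proof (cases "X = qarc h")
    case True
    then show ?thesis using nq arc_group_orbit_qarc qarc_subset by blast
  next
    case False
    then obtain k where k: "X = num_class k" "k \<in> {0, 1, 2, 3}" using \<open>X \<in> ?X\<close> by blast
    then obtain P where P: "P \<in> num_class k" using num_class_nonempty[of k] by auto
    then have "X = orbit (arc_group h) (\<lambda>g. g) P" using k arc_group_orbit_num_class by auto
    moreover have "P \<in> PG3" using P by (simp add: num_class_def)
    ultimately show ?thesis by blast
  qed
  show ?thesis
  proof (intro equalityI subsetI)
    fix X assume "X \<in> orbits (arc_group h) (PG3 :: ('a ^ 4) set set) (\<lambda>g. g)"
    then obtain P where "P \<in> PG3" "X = orbit (arc_group h) (\<lambda>g. g) P"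
      unfolding orbits_def by blast
    then show "X \<in> ?X" by (simp only: 1)
  next
    fix X assume "X \<in> ?X"
    from 2[OF this] show "X \<in> orbits (arc_group h) PG3 (\<lambda>g. g)" unfolding orbits_def by blast
  qed
qed

lemma card_orbits_arc_group:
  "card (orbits (arc_group h) (PG3 :: ('a ^ 4) set set) (\<lambda>g. g)) = 5"
proof -
  have inj: "num_class j \<noteq> num_class k" if "num_class j \<noteq> {}" "j \<noteq> k" for j k
    using that by (auto simp: num_class_def)
  have q: "qarc h \<noteq> num_class k" if "num_class k \<noteq> {}" for k
    using that by (auto simp: num_class_def)
  show ?thesis
    unfolding orbits_arc_group by (simp add: q inj num_class_nonempty)
qed

end

theorem proposition3p2:
  fixes n h q :: nat
    and A O0 O1 O2 O3 :: "('a::{field,finite} ^ 4) set set"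
  assumes "n \<ge> 3" and "h > 0" and "coprime n h"
    and "q = 2 ^ n" and "CARD('a) = q"
  defines "A \<equiv> qarc h"
    and "O0 \<equiv> {P \<in> PG3. \<forall>\<pi> \<in> osculating_planes h. \<not> P \<subseteq> \<pi>}"
    and "O1 \<equiv> {P \<in> PG3 - qarc h. num_osculating h P = 1}"
    and "O2 \<equiv> hyperbolic_quadric - qarc h"
    and "O3 \<equiv> {P \<in> PG3. num_osculating h P = 3}"
  shows "orbits (arc_group h) PG3 (\<lambda>g. g) = {A, O0, O1, O2, O3}
    \<and> card (orbits (arc_group h) (PG3 :: ('a ^ 4) set set) (\<lambda>g. g)) = 5
    \<and> card A = q + 1
    \<and> real (card O0) = (real q ^ 3 - real q) / 3
    \<and> real (card O1) = (real q ^ 3 - real q) / 2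
    \<and> O2 = {P \<in> PG3. num_osculating h P = 2}
    \<and> card O2 = q ^ 2 + q
    \<and> real (card O3) = (real q ^ 3 - real q) / 6"
proof -
  interpret twisted_arc n h "TYPE('a)"
    using assms(1,3,4,5) by unfold_locales simp_all
  \<comment> \<open>Arc points lie on exactly one osculating plane, so for other values of k none of
    them has to be removed.\<close>
  have num: "num_class k = {P \<in> PG3. num_osculating h P = k}" if "k \<noteq> 1" for k
    using that num_osculating_qarc by (auto simp: num_class_def)
  have O: "O0 = num_class 0" "O1 = num_class 1" "O2 = num_class 2" "O3 = num_class 3"
    unfolding O0_def O1_def O2_def O3_def hyperbolic_quadric_diff_qarc
    by (simp_all add: num num_osculating_eq_0_iff) (simp add: num_class_def)
  have q: "q = CARD('a)" using assms by simp
  have "q \<ge> 1" using assms by simp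
  then have r: "real ((q + 1) * (q * (q - 1))) = real q ^ 3 - real q"
    by (simp add: of_nat_diff power3_eq_cube algebra_simps)
  have "real (card (num_class 0) * 3) = real q ^ 3 - real q"
    "real (card (num_class 1) * 2) = real q ^ 3 - real q"
    "real (card (num_class 3) * 6) = real q ^ 3 - real q"
    unfolding card_num_class[OF q] r by simp_all
  moreover have "card (num_class 2) = q ^ 2 + q"
    by (simp add: card_num_class[OF q] power2_eq_square)
  ultimately show ?thesis
    unfolding A_def O orbits_arc_group[symmetric]
    using card_orbits_arc_group card_qarc assms(4) num[of 2] by simp
qed

end
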